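(* Let $\Omega\subset\mathbb{R}^n$ be a fixed bounded Lipschitz domain, let $G$ be a Young function satisfying the standing assumptions given in the context (with exponents $\delta\le g_0$), and let $\lambda>n$. There is a constant $C>0$, depending only on $n,g_0,\lambda$ and the fixed domain $\Omega$, such that the following holds. Let $u:\Omega\to\mathbb{R}$ be a measurable function satisfying $$\int_\Omega G(|u|)\,dx+\sup_{x_0\in\Omega,\ \varrho>0}\varrho^{-\lambda}\inf_{\xi\in\mathbb{R}}\int_{\Omega\cap B_\varrho(x_0)}G(|u(x)-\xi|)\,dx\le C_0$$ for some positive constant $C_0$. Then $u\in C^{0,\gamma}(\Omega)$ with $\gamma=\frac{\lambda-n}{g_0+1}$, and $$\sup_{x,y\in\Omega,\ x\ne y}\frac{|u(x)-u(y)|}{|x-y|^\gamma}\le C\,G^{-1}\left(\sup_{x_0\in\Omega,\ \varrho>0}\varrho^{-\lambda}\inf_{\xi\in\mathbb{R}}\int_{\Omega\cap B_\varrho(x_0)}G(|u(x)-\xi|)\,dx\right).$$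
   Context: $B_\varrho(x_0)$ is the open ball of radius $\varrho$ centered at $x_0$ in $\mathbb{R}^n$. A Young function is a function $G:[0,\infty)\to[0,\infty)$ of the form $G(t)=\int_0^t g(\tau)\,d\tau$ with $g$ right-continuous on $[0,\infty)$, $g(0)=0$, $g(t)>0$ for $t>0$, $g$ nondecreasing on $(0,\infty)$ and $\lim_{t\to\infty}g(t)=\infty$. $G$ is strictly increasing, and $G^{-1}$ denotes its inverse. Standing assumptions on $G$: $G(1)=1$; $g=G'$ is absolutely continuous and convex; there are constants $1<\delta\le g_0<\infty$ with $\delta\le \frac{tg'(t)}{g(t)}\le g_0$ for all $t>0$; and $\frac{n(\delta+1)}{n-(\delta+1)}>g_0+1$. Functions are identified with their continuous representative, i.e. the conclusion holds after modifying $u$ on a set of measure zero. *)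

theory Defs
  imports "HOL-Analysis.Analysis"
begin

text \<open>
  Functions on \<open>[0,\<infinity>)\<close> are represented by functions on the whole real line; only their
  restriction to \<open>[0,\<infinity>)\<close> is ever constrained or used.
\<close>

definition young_with_density :: "(real \<Rightarrow> real) \<Rightarrow> (real \<Rightarrow> real) \<Rightarrow> bool" where
  "young_with_density G g \<longleftrightarrow>
     g 0 = 0 \<and> (\<forall>t>0. g t > 0) \<and> mono_on {0<..} g \<and>
     (\<forall>t\<ge>0. continuous (at_right t) g) \<and>
     filterlim g at_top at_top \<and>
     (\<forall>t\<ge>0. (g has_integral G t) {0..t})"

definition young_inverse :: "(real \<Rightarrow> real) \<Rightarrow> real \<Rightarrow> real" where
  "young_inverse G = inv_into {0..} G"

definition absolutely_continuous_fun_on :: "real set \<Rightarrow> (real \<Rightarrow> real) \<Rightarrow> bool" where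
  "absolutely_continuous_fun_on S f \<longleftrightarrow>
     (\<forall>\<epsilon>>0. \<exists>\<eta>>0. \<forall>I.
        finite I \<and> (\<forall>(a, b)\<in>I. a < b \<and> {a..b} \<subseteq> S) \<and>
        disjoint_family_on (\<lambda>(a, b). {a<..<b}) I \<and> (\<Sum>(a, b)\<in>I. b - a) < \<eta>
        \<longrightarrow> (\<Sum>(a, b)\<in>I. \<bar>f b - f a\<bar>) < \<epsilon>)"

text \<open>
  Absolute continuity of \<open>g\<close> on the unbounded interval \<open>[0,\<infinity>)\<close> is the usual local notion:
  on every compact subinterval. (The uniform version fails already for \<open>g(t) = t\<^sup>p\<close>, \<open>p > 1\<close>.)
  Absolute continuity provides \<open>g'\<close> only almost everywhere, so the bounds on
  \<open>t g'(t) / g(t)\<close> are required at every \<open>t > 0\<close> at which \<open>g'(t)\<close> exists; by convexity these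
  are all \<open>t > 0\<close> up to a countable set, and no differentiability of \<open>g\<close> is assumed beyond that.
  The last conjunct forces \<open>\<delta> + 1 < n\<close>.
\<close>

definition young_standing :: "nat \<Rightarrow> real \<Rightarrow> real \<Rightarrow> (real \<Rightarrow> real) \<Rightarrow> bool" where
  "young_standing n \<delta> g0 G \<longleftrightarrow>
     G 1 = 1 \<and> 1 < \<delta> \<and> \<delta> \<le> g0 \<and>
     (\<exists>g. young_with_density G g \<and>
          (\<forall>T>0. absolutely_continuous_fun_on {0..T} g) \<and>
          convex_on {0..} g \<and>
          (\<forall>t>0. g differentiable (at t) \<longrightarrow>
             \<delta> \<le> t * deriv g t / g t \<and> t * deriv g t / g t \<le> g0)) \<and>
     real n * (\<delta> + 1) / (real n - (\<delta> + 1)) > g0 + 1"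

text \<open>
  Near each boundary point the set lies strictly above the graph of a Lipschitz function in
  suitable orthonormal coordinates. The unit vector \<open>e\<close> is the last coordinate direction,
  \<open>x \<bullet> e\<close> the last coordinate of \<open>x\<close>, and \<open>x - (x \<bullet> e) *\<^sub>R e\<close> its projection to the
  hyperplane orthogonal to \<open>e\<close>.
\<close>

definition lipschitz_domain :: "(real ^ 'n) set \<Rightarrow> bool" where
  "lipschitz_domain \<Omega> \<longleftrightarrow>
     open \<Omega> \<and> connected \<Omega> \<and> \<Omega> \<noteq> {} \<and>
     (\<forall>p\<in>frontier \<Omega>. \<exists>r>0. \<exists>e L \<phi>.
        norm e = 1 \<and> L-lipschitz_on {y. y \<bullet> e = 0} \<phi> \<and>
        \<Omega> \<inter> ball p r = {x \<in> ball p r. x \<bullet> e > (\<phi> (x - (x \<bullet> e) *\<^sub>R e) :: real)})"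

definition campanato_seminorm ::
    "(real \<Rightarrow> real) \<Rightarrow> real \<Rightarrow> (real ^ 'n) set \<Rightarrow> (real ^ 'n \<Rightarrow> real) \<Rightarrow> ennreal" where
  "campanato_seminorm G lam \<Omega> u =
     (SUP x0\<in>\<Omega>. SUP \<rho>\<in>{0<..}. ennreal (\<rho> powr (- lam)) *
        (INF \<xi>. \<integral>\<^sup>+x\<in>\<Omega> \<inter> ball x0 \<rho>. ennreal (G \<bar>u x - \<xi>\<bar>) \<partial>lebesgue))"

definition hoelder_seminorm :: "real \<Rightarrow> (real ^ 'n) set \<Rightarrow> (real ^ 'n \<Rightarrow> real) \<Rightarrow> ennreal" where
  "hoelder_seminorm \<gamma> \<Omega> v =
     (SUP x\<in>\<Omega>. SUP y\<in>\<Omega> - {x}. ennreal (\<bar>v x - v y\<bar> / norm (x - y) powr \<gamma>))"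

text \<open>No upper bound on the exponent is imposed.\<close>

definition hoelder_space :: "real \<Rightarrow> (real ^ 'n) set \<Rightarrow> (real ^ 'n \<Rightarrow> real) set" where
  "hoelder_space \<gamma> \<Omega> =
     {v. continuous_on \<Omega> v \<and> bounded (v ` \<Omega>) \<and> hoelder_seminorm \<gamma> \<Omega> v < \<infinity>}"

end

theory Submission
  imports Defs "HOL-Real_Asymp.Real_Asymp"
begin

text \<open>
  Write \<open>K\<close> for the Campanato seminorm and let \<open>K < G T\<close>. For each centre and each radius \<open>\<rho>\<close> a
  constant \<open>\<xi>\<close> nearly attaining the infimum satisfies \<open>|{|u - \<xi>| \<ge> t}| \<le> \<rho>\<^sup>\<lambda> G(T)/G(t)\<close> by Chebyshev's
  inequality. Since \<open>G(\<theta> t) \<ge> \<theta> powr (g0 + 1) * G t\<close> for \<open>\<theta> \<le> 1\<close>, the choice \<open>t = M \<rho>\<^sup>\<gamma> T\<close> makes this an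
  arbitrarily small multiple of \<open>\<rho>\<^sup>n\<close>, whereas a Lipschitz domain fills a fixed proportion of every
  small ball centred in it. Hence the good sets of two neighbouring balls of comparable radius
  meet, their constants differ by at most \<open>2t\<close>, and the constants converge along dyadic radii to a
  Hoelder continuous function with constant proportional to \<open>T\<close>. Finally \<open>T\<close> decreases to the
  inverse of \<open>G\<close> at \<open>K\<close>.
\<close>

subsection \<open>Scaling of Young functions\<close>

lemma uncountable_Ioo_minus_countable:
  fixes a b :: real
  assumes "countable X" "a < b"
  obtains x where "a < x" "x < b" "x \<notin> X"
proof -
  have "uncountable ({a<..<b} - X)"
    using assms uncountable_minus_countable uncountable_open_interval by blast
  then obtain x where "x \<in> {a<..<b} - X"
    by (metis countable_empty ex_in_conv)
  then show ?thesis using that by auto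
qed

text \<open>The standing assumptions control \<open>deriv g\<close> only where it exists, so a
  subgradient \<open>r\<close> defined everywhere is extracted. It is monotone, hence discontinuous
  on a countable set only, and at a point of continuity the difference quotients are squeezed to
  \<open>r x\<close>.\<close>

lemma convex_on_subgradient_countable:
  fixes g :: "real \<Rightarrow> real"
  assumes conv: "convex_on {0<..} g"
  shows "\<exists>X r. countable X \<and> (\<forall>x>0. \<forall>y>0. g x + r x * (y - x) \<le> g y) \<and>
    (\<forall>x>0. x \<notin> X \<longrightarrow> (g has_field_derivative r x) (at x))"
proof -
  \<comment> \<open>This is the right derivative, as the infimum of the difference quotients to the
    right.\<close>
  define r where "r x = Inf ((\<lambda>t. (g x - g t) / (x - t)) ` ({x<..} \<inter> {0<..}))" for x
  have sub: "g x + r x * (y - x) \<le> g y" if "0 < x" "0 < y" for x y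
    using convex_le_Inf_differential[OF conv, of x y] that unfolding r_def by (auto simp: interior_open)
  have slope: "r x \<le> (g y - g x) / (y - x)" "(g y - g x) / (y - x) \<le> r y"
    if "0 < x" "x < y" for x y
    using sub[of x y] sub[of y x] that by (auto simp: field_simps)
  have mono: "mono_on {0<..} r"
  proof (rule mono_onI)
    fix x y :: real assume "x \<in> {0<..}" "y \<in> {0<..}" "x \<le> y"
    then show "r x \<le> r y" using slope[of x y] by (cases "x = y") auto
  qed
  define X where "X = {x\<in>{0<..}. \<not> isCont r x}"
  have "countable X"
    unfolding X_def by (rule mono_on_ctble_discont_open[OF open_greaterThan mono])
  moreover have "(g has_field_derivative r x) (at x)" if "0 < x" "x \<notin> X" for x
  proof -
    have lim: "(r \<longlongrightarrow> r x) (at x)"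
      using that by (auto simp: X_def isCont_def)
    have pos: "\<forall>\<^sub>F y in at x. 0 < y"
      using \<open>0 < x\<close> by (simp add: eventually_at_in_open' eventually_at_topological)
         (meson greaterThan_iff open_greaterThan)
    have ne: "\<forall>\<^sub>F y in at x. y \<noteq> x"
      by (simp add: eventually_neq_at_within)
    \<comment> \<open>The quotient lies between \<open>r x\<close> and \<open>r y\<close>, in an
      order that depends on the side of \<open>x\<close> on which \<open>y\<close> lies;
      \<open>min\<close> and \<open>max\<close> treat both sides at once.\<close>
    have l: "\<forall>\<^sub>F y in at x. min (r x) (r y) \<le> (g y - g x) / (y - x)"
      using pos ne
    proof eventually_elim
      case (elim y)
      show ?case
      proof (cases "x < y")
        case True then show ?thesis using slope[of x y] \<open>0 < x\<close> by (simp add: min.coboundedI1)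
      next
        case False
        then have "(g x - g y) / (x - y) = (g y - g x) / (y - x)"
          using minus_divide_divide[of "g y - g x" "y - x"] by simp
        then show ?thesis using slope[of y x] False elim by (simp add: min.coboundedI2)
      qed
    qed
    have u: "\<forall>\<^sub>F y in at x. (g y - g x) / (y - x) \<le> max (r x) (r y)"
      using pos ne
    proof eventually_elim
      case (elim y)
      show ?case
      proof (cases "x < y")
        case True then show ?thesis using slope[of x y] \<open>0 < x\<close> by (simp add: max.coboundedI2)
      next
        case False
        then have "(g x - g y) / (x - y) = (g y - g x) / (y - x)"
          using minus_divide_divide[of "g y - g x" "y - x"] by simp
        then show ?thesis using slope[of y x] False elim by (simp add: max.coboundedI1)
      qed
    qed
    have "((\<lambda>y. (g y - g x) / (y - x)) \<longlongrightarrow> r x) (at x)"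
    proof (rule tendsto_sandwich[OF l u])
      show "((\<lambda>y. min (r x) (r y)) \<longlongrightarrow> r x) (at x)"
        using tendsto_min[OF tendsto_const lim, of "r x"] by simp
      show "((\<lambda>y. max (r x) (r y)) \<longlongrightarrow> r x) (at x)"
        using tendsto_max[OF tendsto_const lim, of "r x"] by simp
    qed
    then show ?thesis by (simp add: has_field_derivative_iff)
  qed
  ultimately show ?thesis using sub by (intro exI[of _ X] exI[of _ r]) auto
qed

text \<open>
  The subgradient inequality gives \<open>g x \<ge> (1 - g0 * (y - x) / y) * g y\<close> for \<open>x < y\<close>; iterating it
  along a geometric partition of \<open>[\<theta> t, t]\<close> yields the power in the limit. This avoids
  integrating \<open>g'\<close>, which exists only off a countable set.
\<close>

lemma convex_growth_powr:
  fixes g :: "real \<Rightarrow> real"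
  assumes conv: "convex_on {0<..} g" and gpos: "\<And>t. t > 0 \<Longrightarrow> g t > 0"
    and der: "\<And>t. t > 0 \<Longrightarrow> g differentiable (at t) \<Longrightarrow> t * deriv g t / g t \<le> g0"
    and t: "0 < t" and \<theta>: "0 < \<theta>" "\<theta> < 1"
  shows "\<theta> powr g0 * g t \<le> g (\<theta> * t)"
proof -
  obtain X r where X: "countable X"
    and sub: "\<And>x y. 0 < x \<Longrightarrow> 0 < y \<Longrightarrow> g x + r x * (y - x) \<le> g y"
    and dr: "\<And>x. 0 < x \<Longrightarrow> x \<notin> X \<Longrightarrow> (g has_field_derivative r x) (at x)"
    using convex_on_subgradient_countable[OF conv] by auto
  have cont: "isCont g x" if "x > 0" for x
    using convex_on_continuous[OF open_greaterThan conv] that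
    by (simp add: continuous_on_eq_continuous_at)
  have step0: "g y * (1 - g0 * (y - x) / y) \<le> g x" if "0 < x" "x < y" "y \<notin> X" for x y
  proof -
    have "0 < y" using that by simp
    have "deriv g y = r y" "g differentiable (at y)"
      using dr[OF \<open>0 < y\<close> \<open>y \<notin> X\<close>]
      by (auto simp: DERIV_imp_deriv real_differentiable_def)
    then have "r y \<le> g0 * g y / y"
      using der[OF \<open>0 < y\<close>] gpos[OF \<open>0 < y\<close>] \<open>0 < y\<close> by (simp add: field_simps)
    then have "r y * (y - x) \<le> g0 * g y / y * (y - x)"
      using that by (intro mult_right_mono) auto
    moreover have "g y - r y * (y - x) \<le> g x"
      using sub[of y x] \<open>0 < y\<close> that by (simp add: algebra_simps)
    ultimately have "g y - g0 * g y / y * (y - x) \<le> g x" by simp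
    then show ?thesis by (simp add: algebra_simps)
  qed
  \<comment> \<open>If the bound failed at \<open>y\<close>, it would fail on a right neighbourhood
    of \<open>y\<close> by continuity. That neighbourhood contains a point outside the countable set
    \<open>X\<close>, contrary to \<open>step0\<close>.\<close>
  have step: "g y * (1 - g0 * (y - x) / y) \<le> g x" if "0 < x" "x < y" for x y
  proof (rule ccontr)
    assume "\<not> ?thesis"
    then have "g x < g y * (1 - g0 * (y - x) / y)" by simp
    moreover have "((\<lambda>z. g z * (1 - g0 * (z - x) / z)) \<longlongrightarrow> g y * (1 - g0 * (y - x) / y)) (at_right y)"
      using cont[of y] that
      by (intro tendsto_intros) (auto simp: isCont_def filterlim_at_split)
    ultimately have "\<forall>\<^sub>F z in at_right y. g x < g z * (1 - g0 * (z - x) / z)"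
      by (simp add: order_tendstoD(1))
    then obtain b where "y < b" and b: "\<And>z. y < z \<Longrightarrow> z < b \<Longrightarrow> g x < g z * (1 - g0 * (z - x) / z)"
      by (auto simp: eventually_at_right_field)
    obtain z where "y < z" "z < b" "z \<notin> X"
      using uncountable_Ioo_minus_countable[OF X \<open>y < b\<close>] by blast
    with b[of z] step0[of x z] that show False by auto
  qed
  \<comment> \<open>With \<open>q = exp (- c / m)\<close>, exactly \<open>m\<close> steps of ratio
    \<open>q\<close> lead from \<open>t\<close> to \<open>\<theta> * t\<close>.\<close>
  define c where "c = - ln \<theta>"
  have c: "c > 0" "\<theta> = exp (-c)" using \<theta> by (auto simp: c_def)
  have iter: "g t * (1 - g0 * (1 - q)) ^ k \<le> g (q ^ k * t)"
    if "0 < q" "q < 1" "0 \<le> 1 - g0 * (1 - q)" for q k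
  proof (induction k)
    case (Suc k)
    have "g t * (1 - g0 * (1 - q)) ^ Suc k \<le> g (q ^ k * t) * (1 - g0 * (1 - q))"
      using mult_right_mono[OF Suc that(3)] by (simp add: mult_ac)
    also have "\<dots> \<le> g (q ^ Suc k * t)"
    proof -
      define y where "y = q ^ k * t"
      have "0 < y" using that t by (simp add: y_def)
      then have "g0 * (y - q * y) / y = g0 * (1 - q)" by (simp add: field_simps)
      moreover have "0 < q * y" "q * y < y" using that \<open>0 < y\<close> by simp_all
      ultimately have "g y * (1 - g0 * (1 - q)) \<le> g (q * y)" using step[of "q * y" y] by simp
      then show ?thesis by (simp add: y_def mult.assoc)
    qed
    finally show ?case .
  qed simp
  \<comment> \<open>For large \<open>m\<close> the factor of one step is positive, which serves both
    \<open>iter\<close> and the passage between \<open>powr\<close> and natural powers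
    below.\<close>
  have "(\<lambda>m. 1 - g0 * (1 - exp (- c / real m))) \<longlonglongrightarrow> 1"
    by real_asymp
  then have base_pos: "\<forall>\<^sub>F m in sequentially. 0 < 1 - g0 * (1 - exp (- c / real m))"
    by (rule order_tendstoD(1)) simp
  then have ev: "\<forall>\<^sub>F m in sequentially. g t * (1 - g0 * (1 - exp (- c / real m))) ^ m \<le> g (\<theta> * t)"
    using eventually_gt_at_top[of 0]
  proof eventually_elim
    case (elim m)
    have "exp (- c / real m) ^ m = \<theta>"
      using elim c by (simp flip: exp_of_nat_mult)
    then show ?case using iter[of "exp (- c / real m)" m] elim c by simp
  qed
  have "(\<lambda>m. g t * (1 - g0 * (1 - exp (- c / real m))) ^ m) \<longlonglongrightarrow> g t * exp (- (g0 * c))"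
  proof (intro tendsto_intros)
    have "(\<lambda>m. (1 - g0 * (1 - exp (- c / real m))) powr real m) \<longlonglongrightarrow> exp (- (g0 * c))"
      by real_asymp
    then show "(\<lambda>m. (1 - g0 * (1 - exp (- c / real m))) ^ m) \<longlonglongrightarrow> exp (- (g0 * c))"
    proof (rule Lim_transform_eventually)
      show "\<forall>\<^sub>F m in sequentially. (1 - g0 * (1 - exp (- c / real m))) powr real m =
          (1 - g0 * (1 - exp (- c / real m))) ^ m"
        using base_pos by eventually_elim (simp add: powr_realpow)
    qed
  qed
  then have "g t * exp (- (g0 * c)) \<le> g (\<theta> * t)"
    by (rule tendsto_upperbound[OF _ ev]) simp
  then show ?thesis using c \<theta> by (simp add: powr_def mult.commute)
qed

text \<open>Substitution gives \<open>G (a * t) / a\<close> as the integral of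
  \<open>g (a * x)\<close> over \<open>{0..t}\<close>. Comparing integrands, monotonicity of
  \<open>g\<close> yields the first bound and \<open>convex_growth_powr\<close> the second, where
  the Jacobian raises the exponent from \<open>g0\<close> to \<open>g0 + 1\<close>.\<close>

lemma young_scaling:
  assumes st: "young_standing n \<delta> g0 G"
  shows young_convex_scaling: "\<And>a t. 1 \<le> a \<Longrightarrow> 0 \<le> t \<Longrightarrow> a * G t \<le> G (a * t)"
    and young_powr_scaling: "\<And>\<theta> t. 0 < \<theta> \<Longrightarrow> \<theta> \<le> 1 \<Longrightarrow> 0 \<le> t \<Longrightarrow> \<theta> powr (g0 + 1) * G t \<le> G (\<theta> * t)"
    and young_zero: "G 0 = 0" and young_continuous: "continuous_on {0..} G"
proof -
  obtain g where yd: "young_with_density G g" and conv0: "convex_on {0..} g"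
    and der: "\<forall>t>0. g differentiable (at t) \<longrightarrow> \<delta> \<le> t * deriv g t / g t \<and> t * deriv g t / g t \<le> g0"
    using st unfolding young_standing_def by blast
  have g0: "g 0 = 0" and gpos: "\<And>t. t > 0 \<Longrightarrow> g t > 0" and mono: "mono_on {0<..} g"
    and int: "\<And>t. t \<ge> 0 \<Longrightarrow> (g has_integral G t) {0..t}"
    using yd unfolding young_with_density_def by auto
  have conv: "convex_on {0<..} g"
    by (rule convex_on_subset[OF conv0]) auto
  show "G 0 = 0" using has_integral_unique[OF int[of 0], of 0] has_integral_refl(2)[of g 0] by simp
  have scaled: "((\<lambda>x. g (a * x)) has_integral G (a * t) / a) {0..t}" if "a > 0" "t \<ge> 0" for a t
  proof -
    have "(\<lambda>x. x / a) ` {0..a * t} = {0..t}"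
      using that image_divide_atLeastAtMost[of a 0 "a * t"] by auto
    then show ?thesis
      using has_integral_stretch_real[OF int[of "a * t"], of a] that by (simp add: field_simps)
  qed
  show "a * G t \<le> G (a * t)" if "1 \<le> a" "0 \<le> t" for a t
  proof -
    have "G t \<le> G (a * t) / a"
    proof (rule has_integral_le[OF int scaled])
      fix x assume "x \<in> {0..t}"
      then show "g x \<le> g (a * x)"
        using mono_onD[OF mono, of x "a * x"] that by (cases "x = 0") auto
    qed (use that in auto)
    then show ?thesis using that by (simp add: field_simps)
  qed
  show "\<theta> powr (g0 + 1) * G t \<le> G (\<theta> * t)" if "0 < \<theta>" "\<theta> \<le> 1" "0 \<le> t" for \<theta> t
  proof -
    have "\<theta> powr g0 * G t \<le> G (\<theta> * t) / \<theta>"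
    proof (rule has_integral_le[OF has_integral_mult_right[OF int] scaled])
      fix x assume "x \<in> {0..t}"
      then show "\<theta> powr g0 * g x \<le> g (\<theta> * x)"
        using convex_growth_powr[OF conv gpos, of g0 x \<theta>] der that g0
        by (cases "x = 0"; cases "\<theta> = 1") auto
    qed (use that in auto)
    then show ?thesis using that by (simp add: field_simps powr_add)
  qed
  show "continuous_on {0..} G"
  proof -
    \<comment> \<open>Extending \<open>G\<close> to the left by the constant \<open>G 0\<close>
      turns one-sided continuity at \<open>0\<close> into continuity at interior points; on
      \<open>{0..b}\<close> the function \<open>G\<close> is an indefinite integral.\<close>
    have "isCont (\<lambda>x. G (max 0 x)) x" for x
    proof -
      define b where "b = \<bar>x\<bar> + 1"
      have "continuous_on {0..b} (\<lambda>x. integral {0..x} g)"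
        using int[of b] by (intro indefinite_integral_continuous_1) (auto simp: b_def integrable_on_def)
      moreover have "integral {0..x} g = G x" if "x \<in> {0..b}" for x
        using int that by (simp add: integral_unique)
      ultimately have "continuous_on {0..b} G" by (rule continuous_on_cong[THEN iffD1, OF refl, rotated])
      then have "continuous_on {-b<..<b} (\<lambda>x. G (max 0 x))"
        by (rule continuous_on_compose2) (auto intro!: continuous_intros simp: b_def)
      then show ?thesis
        by (rule continuous_on_interior) (auto simp: b_def interior_open)
    qed
    then have "continuous_on {0..} (\<lambda>x. G (max 0 x))"
      by (simp add: continuous_at_imp_continuous_on)
    then show ?thesis by (rule continuous_on_cong[THEN iffD1, rotated -1]) auto
  qed
qed

section \<open>Positivity, strict monotonicity and inversion of \<open>G\<close>\<close>

lemma young_positive: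
  assumes st: "young_standing n \<delta> g0 G" and "0 < t"
  shows "0 < G t"
proof (cases "t \<le> 1")
  case True
  have "t powr (g0 + 1) * G 1 \<le> G t" using young_powr_scaling[OF st, of t 1] True assms by simp
  moreover have "G 1 = 1" using st by (simp add: young_standing_def)
  ultimately show ?thesis using \<open>0 < t\<close> by (smt (verit) powr_gt_zero mult_cancel_left1)
next
  case False
  moreover have "G 1 = 1" using st by (simp add: young_standing_def)
  ultimately show ?thesis using young_convex_scaling[OF st, of t 1] by simp
qed

lemma young_strict_mono:
  assumes st: "young_standing n \<delta> g0 G" and "0 \<le> s" "s < t"
  shows "G s < G t"
proof (cases "s = 0")
  case True then show ?thesis using young_positive[OF st, of t] young_zero[OF st] assms by simp
next
  case False
  then have "0 < G s" using young_positive[OF st] assms by simp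
  moreover have "1 < t / s" using False assms by simp
  ultimately have "1 * G s < t / s * G s" by (intro mult_strict_right_mono)
  also have "t / s * G s \<le> G t" using young_convex_scaling[OF st, of "t / s" s] False assms by simp
  finally show ?thesis by simp
qed

text \<open>Since \<open>G (k + 1) \<ge> k + 1\<close>, the intermediate value theorem provides a
  preimage of \<open>k\<close>, so \<open>inv_into\<close> returns a genuine one.\<close>

lemma young_inverse_works:
  assumes st: "young_standing n \<delta> g0 G" and "0 \<le> k"
  shows "0 \<le> young_inverse G k" "G (young_inverse G k) = k"
proof -
  have "G 1 = 1" using st by (simp add: young_standing_def)
  then have "k \<le> G (k + 1)" using young_convex_scaling[OF st, of "k + 1" 1] \<open>0 \<le> k\<close> by simp
  moreover have "G 0 \<le> k" using young_zero[OF st] \<open>0 \<le> k\<close> by simp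
  moreover have "continuous_on {0..k + 1} G"
    by (rule continuous_on_subset[OF young_continuous[OF st]]) auto
  ultimately obtain x where "0 \<le> x" "G x = k"
    using IVT'[of G 0 k "k + 1"] \<open>0 \<le> k\<close> by auto
  then have "k \<in> G ` {0..}" by auto
  then show "0 \<le> young_inverse G k" "G (young_inverse G k) = k"
    unfolding young_inverse_def using inv_into_into[of k G "{0..}"] f_inv_into_f[of k G "{0..}"] by auto
qed

subsection \<open>Balls inside Lipschitz domains\<close>

text \<open>Moving from \<open>x\<close> by \<open>\<rho> / 2\<close> along \<open>e\<close> gains
  height \<open>\<rho> / 2\<close> above the graph. The perturbation \<open>w\<close> costs at most
  \<open>norm w\<close> in height and \<open>L * norm w\<close> in the graph, which
  \<open>(L + 2) * norm w < \<rho> / 2\<close> absorbs.\<close>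

lemma lipschitz_graph_contains_ball:
  fixes x e :: "'a::real_inner"
  assumes e: "norm e = 1" and lip: "L-lipschitz_on {y. y \<bullet> e = 0} \<phi>"
    and x: "x \<bullet> e > \<phi> (x - (x \<bullet> e) *\<^sub>R e)" and \<rho>: "0 < \<rho>"
    and w: "norm w < \<rho> / (2 * (L + 2))"
  defines "y \<equiv> x + (\<rho> / 2) *\<^sub>R e + w"
  shows "y \<bullet> e > \<phi> (y - (y \<bullet> e) *\<^sub>R e)" and "dist x y < \<rho>"
proof -
  have L: "0 \<le> L" using lip by (rule lipschitz_on_nonneg)
  have ee: "e \<bullet> e = 1" using e by (simp add: norm_eq_1)
  let ?P = "\<lambda>z. z - (z \<bullet> e) *\<^sub>R e"
  have ye: "y \<bullet> e = x \<bullet> e + \<rho> / 2 + w \<bullet> e" by (simp add: y_def inner_add_left ee)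
  have P: "?P y - ?P x = ?P w"
    by (simp add: y_def ye inner_add_left ee algebra_simps)
  \<comment> \<open>Pythagoras: the projection orthogonal to \<open>e\<close> does not increase
    norms.\<close>
  have "(norm (?P w))\<^sup>2 = (norm w)\<^sup>2 - (w \<bullet> e)\<^sup>2"
    unfolding power2_norm_eq_inner
    by (simp add: inner_diff_left inner_diff_right ee inner_commute[of e w] power2_eq_square)
  then have "(norm (?P w))\<^sup>2 \<le> (norm w)\<^sup>2" by simp
  then have Pw: "norm (?P w) \<le> norm w" by (rule power2_le_imp_le) simp
  have "(z - (z \<bullet> e) *\<^sub>R e) \<bullet> e = 0" for z
    unfolding inner_diff_left inner_scaleR_left ee by simp
  then have "dist (\<phi> (?P y)) (\<phi> (?P x)) \<le> L * dist (?P y) (?P x)"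
    using lipschitz_onD[OF lip, of "?P y" "?P x"] by blast
  also have "\<dots> \<le> L * norm w" unfolding dist_norm P using L Pw by (simp add: mult_left_mono)
  finally have "\<phi> (?P y) \<le> \<phi> (?P x) + L * norm w" by (simp add: dist_real_def)
  moreover have "- norm w \<le> w \<bullet> e" using Cauchy_Schwarz_ineq2[of w e] e by simp
  moreover have "(L + 2) * norm w < \<rho> / 2" using w L by (simp add: field_simps)
  moreover have "(L + 2) * norm w = L * norm w + 2 * norm w" by (simp add: distrib_right)
  ultimately show "y \<bullet> e > \<phi> (?P y)" using x ye norm_ge_zero[of w] by linarith
  have "0 \<le> L * norm w" using L by simp
  then have "norm w < \<rho> / 4 \<or> norm w = 0" using \<open>(L + 2) * norm w < \<rho> / 2\<close> by (simp add: algebra_simps)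
  moreover have "dist x y = norm ((\<rho> / 2) *\<^sub>R e + w)"
    by (subst dist_commute) (simp add: y_def dist_norm add.assoc)
  moreover have "norm ((\<rho> / 2) *\<^sub>R e + w) \<le> \<rho> / 2 + norm w"
    using norm_triangle_ineq[of "(\<rho> / 2) *\<^sub>R e" w] e \<rho> by simp
  ultimately show "dist x y < \<rho>" using \<rho> by auto
qed

text \<open>Near an interior point \<open>ball x \<rho>\<close> itself works. At a boundary point
  the small ball is shifted from \<open>x\<close> along \<open>e\<close> to the region above the
  graph; halving \<open>r\<close> keeps \<open>ball x \<rho>\<close> inside \<open>ball p r\<close>,
  where the graph describes \<Omega>.\<close>

lemma lipschitz_domain_contains_ball_locally:
  fixes \<Omega> :: "(real ^ 'n) set"
  assumes lip: "lipschitz_domain \<Omega>" and p: "p \<in> closure \<Omega>"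
  shows "\<exists>r>0. \<exists>s>0. \<forall>x\<in>\<Omega> \<inter> ball p r. \<forall>\<rho>. 0 < \<rho> \<longrightarrow> \<rho> \<le> r \<longrightarrow>
    (\<exists>z. ball z (s * \<rho>) \<subseteq> \<Omega> \<inter> ball x \<rho>)"
proof -
  have "open \<Omega>" using lip by (simp add: lipschitz_domain_def)
  show ?thesis
  proof (cases "p \<in> \<Omega>")
    case True
    then obtain r where r: "r > 0" "ball p r \<subseteq> \<Omega>" using \<open>open \<Omega>\<close> openE by blast
    have "ball x (1 * \<rho>) \<subseteq> \<Omega> \<inter> ball x \<rho>" if "x \<in> ball p (r / 2)" "\<rho> \<le> r / 2" for x \<rho>
    proof -
      have "ball x \<rho> \<subseteq> ball p r"
        using that by (subst ball_subset_ball_iff) (auto simp: dist_commute)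
      then show ?thesis using r by auto
    qed
    then have "\<forall>x\<in>\<Omega> \<inter> ball p (r / 2). \<forall>\<rho>. 0 < \<rho> \<longrightarrow> \<rho> \<le> r / 2 \<longrightarrow> (\<exists>z. ball z (1 * \<rho>) \<subseteq> \<Omega> \<inter> ball x \<rho>)"
      by blast
    then show ?thesis using zero_less_one half_gt_zero[OF \<open>r > 0\<close>] by blast
  next
    case False
    then have "p \<in> frontier \<Omega>" using p \<open>open \<Omega>\<close> by (simp add: frontier_def interior_open)
    then have "\<exists>r>0. \<exists>e L \<phi>. norm e = 1 \<and> L-lipschitz_on {y. y \<bullet> e = 0} \<phi> \<and>
        \<Omega> \<inter> ball p r = {x \<in> ball p r. x \<bullet> e > (\<phi> (x - (x \<bullet> e) *\<^sub>R e) :: real)}"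
      using lip unfolding lipschitz_domain_def by (elim conjE bspec)
    then obtain r e L \<phi> where r: "r > 0" and e: "norm e = 1" and L: "L-lipschitz_on {y. y \<bullet> e = 0} \<phi>"
      and eq: "\<Omega> \<inter> ball p r = {x \<in> ball p r. x \<bullet> e > (\<phi> (x - (x \<bullet> e) *\<^sub>R e) :: real)}"
      by (elim exE conjE)
    define s where "s = 1 / (2 * (L + 2))"
    have "s > 0" using lipschitz_on_nonneg[OF L] by (simp add: s_def)
    have "ball (x + (\<rho> / 2) *\<^sub>R e) (s * \<rho>) \<subseteq> \<Omega> \<inter> ball x \<rho>"
      if x: "x \<in> \<Omega> \<inter> ball p (r / 2)" and \<rho>: "0 < \<rho>" "\<rho> \<le> r / 2" for x \<rho>
    proof
      fix y assume y: "y \<in> ball (x + (\<rho> / 2) *\<^sub>R e) (s * \<rho>)"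
      define w where "w = y - (x + (\<rho> / 2) *\<^sub>R e)"
      have yw: "y = x + (\<rho> / 2) *\<^sub>R e + w" by (simp add: w_def)
      have w: "norm w < \<rho> / (2 * (L + 2))"
        using y by (simp add: w_def s_def dist_norm norm_minus_commute)
      have "x \<in> \<Omega> \<inter> ball p r" using x r by auto
      then have xe: "x \<bullet> e > \<phi> (x - (x \<bullet> e) *\<^sub>R e)" using eq by auto
      note * = lipschitz_graph_contains_ball[OF e L xe \<rho>(1) w, folded yw]
      have "dist p y < r" using *(2) x \<rho> dist_triangle[of p y x] by auto
      then show "y \<in> \<Omega> \<inter> ball x \<rho>" using * eq by auto
    qed
    then have "\<forall>x\<in>\<Omega> \<inter> ball p (r / 2). \<forall>\<rho>. 0 < \<rho> \<longrightarrow> \<rho> \<le> r / 2 \<longrightarrow> (\<exists>z. ball z (s * \<rho>) \<subseteq> \<Omega> \<inter> ball x \<rho>)"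
      by blast
    then show ?thesis using \<open>s > 0\<close> half_gt_zero[OF \<open>r > 0\<close>] by blast
  qed
qed

text \<open>Compactness of the closure reduces the local constants to finitely many.\<close>

lemma lipschitz_domain_contains_ball:
  fixes \<Omega> :: "(real ^ 'n) set"
  assumes lip: "lipschitz_domain \<Omega>" and bdd: "bounded \<Omega>" and "0 < D"
  shows "\<exists>s>0. \<forall>x\<in>\<Omega>. \<forall>\<rho>. 0 < \<rho> \<longrightarrow> \<rho> \<le> D \<longrightarrow> (\<exists>z. ball z (s * \<rho>) \<subseteq> \<Omega> \<inter> ball x \<rho>)"
proof -
  obtain r s where r: "\<And>p. p \<in> closure \<Omega> \<Longrightarrow> r p > 0" and s: "\<And>p. p \<in> closure \<Omega> \<Longrightarrow> s p > 0"
    and rs: "\<And>p x \<rho>. p \<in> closure \<Omega> \<Longrightarrow> x \<in> \<Omega> \<inter> ball p (r p) \<Longrightarrow> 0 < \<rho> \<Longrightarrow> \<rho> \<le> r p \<Longrightarrow>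
      \<exists>z. ball z (s p * \<rho>) \<subseteq> \<Omega> \<inter> ball x \<rho>"
    using lipschitz_domain_contains_ball_locally[OF lip] by metis
  have "compact (closure \<Omega>)" using bdd by (simp add: compact_closure)
  moreover have "\<And>p. p \<in> closure \<Omega> \<Longrightarrow> open (ball p (r p))" by simp
  moreover have "closure \<Omega> \<subseteq> (\<Union>p\<in>closure \<Omega>. ball p (r p))" using r by force
  ultimately obtain F where F: "F \<subseteq> closure \<Omega>" "finite F" "closure \<Omega> \<subseteq> (\<Union>p\<in>F. ball p (r p))"
    by (rule compactE_image)
  have "\<Omega> \<noteq> {}" using lip by (simp add: lipschitz_domain_def)
  then have "F \<noteq> {}" using F(3) closure_subset[of \<Omega>] by auto
  \<comment> \<open>The factor \<open>min 1 (r p / D)\<close> accounts for radii between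
    \<open>r p\<close> and \<open>D\<close>, for which the ball found at radius \<open>r p\<close>
    is used.\<close>
  define t where "t = Min ((\<lambda>p. s p * min 1 (r p / D)) ` F)"
  have t: "t > 0" unfolding t_def using F(1,2) \<open>F \<noteq> {}\<close> r s \<open>0 < D\<close>
    by (subst Min_gr_iff) (auto intro!: mult_pos_pos)
  have "\<exists>z. ball z (t * \<rho>) \<subseteq> \<Omega> \<inter> ball x \<rho>" if x: "x \<in> \<Omega>" and \<rho>: "0 < \<rho>" "\<rho> \<le> D" for x \<rho>
  proof -
    obtain p where p: "p \<in> F" "x \<in> ball p (r p)" using F(3) x closure_subset[of \<Omega>] by blast
    have pc: "p \<in> closure \<Omega>" using p F by auto
    obtain z where z: "ball z (s p * min \<rho> (r p)) \<subseteq> \<Omega> \<inter> ball x (min \<rho> (r p))"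
      using rs[OF pc, of x "min \<rho> (r p)"] x p \<rho> r[OF pc] by auto
    have "t \<le> s p * min 1 (r p / D)" unfolding t_def using p F by (intro Min_le) auto
    then have "t * \<rho> \<le> s p * (min 1 (r p / D) * \<rho>)"
      using \<rho> mult_right_mono[of t _ \<rho>] by (simp add: mult.assoc)
    also have "min 1 (r p / D) * \<rho> \<le> min \<rho> (r p)"
    proof -
      have "r p / D * \<rho> \<le> r p * 1" using \<rho> r[OF pc] \<open>0 < D\<close> by (simp add: field_simps)
      moreover have "min 1 (r p / D) * \<rho> \<le> 1 * \<rho>" "min 1 (r p / D) * \<rho> \<le> r p / D * \<rho>"
        using \<rho> by (intro mult_right_mono; simp)+
      ultimately show ?thesis by simp
    qed
    finally have "t * \<rho> \<le> s p * min \<rho> (r p)" using s[OF pc] by simp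
    then have "ball z (t * \<rho>) \<subseteq> ball z (s p * min \<rho> (r p))" by (rule subset_ball)
    moreover have "ball x (min \<rho> (r p)) \<subseteq> ball x \<rho>" by (rule subset_ball) simp
    ultimately show ?thesis using z by blast
  qed
  then show ?thesis using t by blast
qed

subsection \<open>Dyadic limits and coverings\<close>

text \<open>The increments are dominated by a geometric series, whose tail from \<open>k\<close> on
  is the bound.\<close>

lemma dyadic_limit:
  fixes \<xi> :: "nat \<Rightarrow> real"
  assumes q: "0 < q" "q < 1" and step: "\<And>k. \<bar>\<xi> k - \<xi> (Suc k)\<bar> \<le> N * q ^ k"
  shows "\<bar>lim \<xi> - \<xi> k\<bar> \<le> N / (1 - q) * q ^ k"
proof -
  have "0 \<le> N" using step[of 0] by (smt (verit) mult_cancel_left2 power_0)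
  have sm: "summable (\<lambda>k. \<bar>\<xi> (Suc k) - \<xi> k\<bar>)"
  proof (rule summable_comparison_test')
    show "summable (\<lambda>k. N * q ^ k)" using q by (intro summable_mult summable_geometric) simp
    show "norm \<bar>\<xi> (Suc k) - \<xi> k\<bar> \<le> N * q ^ k" if "k \<ge> 0" for k
      using step[of k] by (simp add: abs_minus_commute)
  qed
  obtain L where "(\<lambda>n. \<xi> n - \<xi> 0) \<longlonglongrightarrow> L"
    using summable_rabs_cancel[OF sm] unfolding summable_def sums_def sum_lessThan_telescope by blast
  then have "(\<lambda>n. \<xi> n - \<xi> 0 + \<xi> 0) \<longlonglongrightarrow> L + \<xi> 0" by (intro tendsto_intros)
  then have lim: "\<xi> \<longlonglongrightarrow> lim \<xi>"
    unfolding diff_add_cancel using convergentI convergent_LIMSEQ_iff by blast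
  \<comment> \<open>Keeping the factor \<open>1 - q ^ m\<close> of the partial geometric sum lets
    the induction close with an identity.\<close>
  have close: "\<bar>\<xi> (k + m) - \<xi> k\<bar> \<le> N / (1 - q) * q ^ k * (1 - q ^ m)" for m
  proof (induction m)
    case (Suc m)
    have "N / (1 - q) * q ^ k * (1 - q ^ m) + N * q ^ (k + m) = N / (1 - q) * q ^ k * (1 - q ^ Suc m)"
      using q by (simp add: field_simps power_add)
    then show ?case using Suc step[of "k + m"] by simp
  qed simp
  have "\<bar>\<xi> (m + k) - \<xi> k\<bar> \<le> N / (1 - q) * q ^ k" for m
  proof -
    have "N / (1 - q) * q ^ k * (1 - q ^ m) \<le> N / (1 - q) * q ^ k * 1"
      using q \<open>0 \<le> N\<close> by (intro mult_left_mono) auto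
    then show ?thesis using close[of m] by (simp add: add.commute)
  qed
  moreover have "(\<lambda>m. \<bar>\<xi> (m + k) - \<xi> k\<bar>) \<longlonglongrightarrow> \<bar>lim \<xi> - \<xi> k\<bar>"
    by (intro tendsto_intros LIMSEQ_ignore_initial_segment lim)
  ultimately show ?thesis by (intro LIMSEQ_le_const2) auto
qed

text \<open>Taking \<open>x = y\<close> in \<open>step\<close> gives convergence at each point. Two
  points are compared at the dyadic level of their distance, through the chain \<open>v x\<close>,
  \<open>\<xi> k x\<close>, \<open>\<xi> (Suc k) y\<close>, \<open>v y\<close>.\<close>

lemma dyadic_hoelder_limit:
  fixes \<xi> :: "nat \<Rightarrow> 'a::metric_space \<Rightarrow> real"
  assumes \<gamma>: "0 < \<gamma>" and D: "0 < D" and q: "q = 2 powr (- \<gamma>)"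
    and diam: "\<And>x y. x \<in> S \<Longrightarrow> y \<in> S \<Longrightarrow> dist x y \<le> D / 2"
    and step: "\<And>k x y. x \<in> S \<Longrightarrow> y \<in> S \<Longrightarrow> dist x y \<le> D / 2 ^ Suc k \<Longrightarrow>
      \<bar>\<xi> k x - \<xi> (Suc k) y\<bar> \<le> N * q ^ k"
    and x: "x \<in> S" and y: "y \<in> S"
  defines "v \<equiv> \<lambda>x. lim (\<lambda>k. \<xi> k x)"
  shows "\<bar>v x - \<xi> k x\<bar> \<le> N / (1 - q) * q ^ k"
    and "\<bar>v x - v y\<bar> \<le> (2 / (1 - q) + 1) * N * (4 / D) powr \<gamma> * dist x y powr \<gamma>"
proof -
  have q01: "0 < q" "q < 1" using \<gamma> powr_less_cancel_iff[of 2 "- \<gamma>" 0] by (auto simp: q)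
  have close: "\<bar>v z - \<xi> k z\<bar> \<le> N / (1 - q) * q ^ k" if "z \<in> S" for z k
    unfolding v_def using step[OF that that] D by (intro dyadic_limit q01) auto
  show "\<bar>v x - \<xi> k x\<bar> \<le> N / (1 - q) * q ^ k" by (rule close[OF x])
  have "0 \<le> N * q ^ 0" using step[OF x x, of 0] D by (smt (verit) dist_self divide_nonneg_pos zero_less_power)
  then have N: "0 \<le> N" by simp
  show "\<bar>v x - v y\<bar> \<le> (2 / (1 - q) + 1) * N * (4 / D) powr \<gamma> * dist x y powr \<gamma>"
  proof (cases "x = y")
    case False
    define d where "d = dist x y"
    have d: "0 < d" "d \<le> D / 2" using False diam[OF x y] by (auto simp: d_def)
    have "(\<lambda>j. D * (1 / 2) ^ j) \<longlonglongrightarrow> D * 0" by (intro tendsto_intros) simp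
    then have "\<forall>\<^sub>F j in sequentially. D * (1 / 2) ^ j < d"
      using d by (intro order_tendstoD(2)) auto
    then obtain j where "D * (1 / 2) ^ j < d" by (auto simp: eventually_sequentially)
    then have ex: "\<exists>j. D / 2 ^ j < d" by (auto simp: field_simps power_one_over)
    \<comment> \<open>Since \<open>d \<le> D / 2\<close>, the least such \<open>j\<close> is at
      least 2. With \<open>j = k + 2\<close>, minimality gives \<open>d \<le> D / 2 ^ Suc k\<close>,
      just what \<open>step\<close> requires at level \<open>k\<close>.\<close>
    define j where "j = (LEAST j. D / 2 ^ j < d)"
    have j: "D / 2 ^ j < d" unfolding j_def by (rule LeastI_ex[OF ex])
    have "j \<noteq> 0" "j \<noteq> 1"
    proof -
      show "j \<noteq> 0" using j d by (intro notI) simp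
      show "j \<noteq> 1" using j d by (intro notI) simp
    qed
    then obtain k where k: "j = Suc (Suc k)" by (metis One_nat_def not0_implies_Suc)
    have "Suc k < (LEAST j. D / 2 ^ j < d)" using k by (simp add: j_def)
    then have "\<not> D / 2 ^ Suc k < d" by (rule not_less_Least)
    then have dk: "d \<le> D / 2 ^ Suc k" by simp
    \<comment> \<open>The bound \<open>D / 2 ^ (k + 2) < d\<close> turns the decay in
      \<open>k\<close> into a power of the distance; this is the origin of the factor
      \<open>4 / D\<close>.\<close>
    have "q ^ k = (1 / 2 ^ k) powr \<gamma>"
      by (simp add: q powr_minus_divide powr_divide power_one_over powr_power powr_powr mult.commute flip: powr_realpow)
    also have "\<dots> \<le> (4 / D * d) powr \<gamma>"
      using j D d \<gamma> by (intro powr_mono2) (auto simp: k field_simps)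
    finally have qk: "q ^ k \<le> (4 / D) powr \<gamma> * d powr \<gamma>" unfolding powr_mult .
    have "N / (1 - q) * q ^ Suc k \<le> N / (1 - q) * q ^ k"
      using q01 N by (intro mult_left_mono power_decreasing) auto
    then have "\<bar>v x - v y\<bar> \<le> N / (1 - q) * q ^ k + N * q ^ k + N / (1 - q) * q ^ k"
      using close[OF x, of k] close[OF y, of "Suc k"] step[OF x y dk[unfolded d_def]] by linarith
    also have "\<dots> = (2 / (1 - q) + 1) * N * q ^ k" by (simp add: algebra_simps)
    also have "\<dots> \<le> (2 / (1 - q) + 1) * N * ((4 / D) powr \<gamma> * d powr \<gamma>)"
      using N q01 qk by (intro mult_left_mono mult_nonneg_nonneg add_nonneg_nonneg) auto
    finally show ?thesis by (simp add: d_def mult.assoc)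
  qed simp
qed

text \<open>Volume comparison: the balls of radius \<open>\<rho> / 2\<close> about the points of
  \<open>F\<close> are disjoint and lie in the ball of radius \<open>R + 1\<close> about the
  origin.\<close>

lemma separated_card_bound:
  fixes \<Omega> :: "'a::euclidean_space set"
  assumes \<Omega>: "\<Omega> \<subseteq> cball 0 R" and R: "0 \<le> R" and \<rho>: "0 < \<rho>" "\<rho> \<le> 1"
    and F: "F \<subseteq> \<Omega>" "finite F" "\<And>x y. x \<in> F \<Longrightarrow> y \<in> F \<Longrightarrow> x \<noteq> y \<Longrightarrow> \<rho> \<le> dist x y"
  shows "real (card F) * \<rho> ^ DIM('a) \<le> (2 * (R + 1)) ^ DIM('a)"
proof -
  let ?V = "unit_ball_vol (real DIM('a))"
  have disj: "disjoint_family_on (\<lambda>x. ball x (\<rho> / 2)) F"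
    unfolding disjoint_family_on_def
  proof (intro ballI impI equals0I)
    fix x y z assume "x \<in> F" "y \<in> F" "x \<noteq> y" "z \<in> ball x (\<rho> / 2) \<inter> ball y (\<rho> / 2)"
    then show False using F(3)[of x y] dist_triangle2[of x y z] by (auto simp: dist_commute)
  qed
  have "(\<Sum>x\<in>F. measure lebesgue (ball x (\<rho> / 2))) = measure lebesgue (\<Union>x\<in>F. ball x (\<rho> / 2))"
    by (rule measure_finite_Union[symmetric]) (use F disj in \<open>auto simp: emeasure_ball \<rho> less_imp_le\<close>)
  also have "\<dots> \<le> measure lebesgue (ball (0::'a) (R + 1))"
  proof (rule measure_mono_fmeasurable)
    show "(\<Union>x\<in>F. ball x (\<rho> / 2)) \<subseteq> ball 0 (R + 1)"
    proof
      fix z assume "z \<in> (\<Union>x\<in>F. ball x (\<rho> / 2))"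
      then obtain x where "x \<in> F" "dist x z < \<rho> / 2" by auto
      moreover have "norm x \<le> R" using \<open>x \<in> F\<close> F(1) \<Omega> by auto
      ultimately show "z \<in> ball 0 (R + 1)" using \<rho> norm_triangle_ineq2[of z x]
        by (auto simp: dist_norm norm_minus_commute)
    qed
  qed (use F in auto)
  finally have "real (card F) * (?V * (\<rho> / 2) ^ DIM('a)) \<le> ?V * (R + 1) ^ DIM('a)"
    using \<rho> R by (simp add: content_ball)
  then have "?V * (real (card F) * (\<rho> / 2) ^ DIM('a)) \<le> ?V * (R + 1) ^ DIM('a)" by (simp add: mult_ac)
  then have "real (card F) * (\<rho> / 2) ^ DIM('a) \<le> (R + 1) ^ DIM('a)" by simp
  then show ?thesis unfolding power_mult_distrib by (simp add: power_divide field_simps)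
qed

text \<open>A separated subset of maximal cardinality covers, because an uncovered point could be
  added to it. The packing bound guarantees that a maximum exists.\<close>

lemma finite_ball_covering:
  fixes \<Omega> :: "'a::euclidean_space set"
  assumes \<Omega>: "\<Omega> \<subseteq> cball 0 R" and R: "0 \<le> R" and \<rho>: "0 < \<rho>" "\<rho> \<le> 1"
  shows "\<exists>F\<subseteq>\<Omega>. finite F \<and> \<Omega> \<subseteq> (\<Union>x\<in>F. ball x \<rho>) \<and>
    real (card F) * \<rho> ^ DIM('a) \<le> (2 * (R + 1)) ^ DIM('a)"
proof -
  define P where "P F \<longleftrightarrow> F \<subseteq> \<Omega> \<and> finite F \<and> (\<forall>x\<in>F. \<forall>y\<in>F. x \<noteq> y \<longrightarrow> \<rho> \<le> dist x y)" for F
  have bound: "real (card F) * \<rho> ^ DIM('a) \<le> (2 * (R + 1)) ^ DIM('a)" if "P F" for F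
    using that unfolding P_def by (intro separated_card_bound[OF \<Omega> R \<rho>]) auto
  define m where "m = nat \<lceil>(2 * (R + 1)) ^ DIM('a) / \<rho> ^ DIM('a)\<rceil>"
  have "card F < Suc m" if "P F" for F
  proof -
    have "real (card F) \<le> (2 * (R + 1)) ^ DIM('a) / \<rho> ^ DIM('a)"
      using bound[OF that] \<rho> by (simp add: field_simps)
    then show ?thesis unfolding m_def by linarith
  qed
  moreover have "P {}" by (simp add: P_def)
  ultimately obtain F where F: "P F" and max: "\<And>F'. P F' \<Longrightarrow> card F' \<le> card F"
    using ex_has_greatest_nat[of P "{}" card "Suc m"] by (metis less_imp_le)
  have "\<Omega> \<subseteq> (\<Union>x\<in>F. ball x \<rho>)"
  proof
    fix x assume x: "x \<in> \<Omega>"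
    show "x \<in> (\<Union>x\<in>F. ball x \<rho>)"
    proof (rule ccontr)
      assume n: "x \<notin> (\<Union>x\<in>F. ball x \<rho>)"
      then have "P (insert x F)" using F x unfolding P_def by (auto simp: dist_commute not_less)
      moreover have "x \<notin> F" using n \<rho> by auto
      ultimately show False using max[of "insert x F"] F by (simp add: P_def)
    qed
  qed
  then show ?thesis using F bound[OF F] unfolding P_def by blast
qed

text \<open>
  This replaces Lebesgue differentiation: since \<open>lam\<close> exceeds the dimension, the exceptional sets in a
  cover by \<open>O(\<rho>\<^sup>-\<^sup>n)\<close> balls of radius \<open>\<rho>\<close> have total measure tending to \<open>0\<close>.
\<close>

lemma negligible_ne_of_local_approximation:
  fixes \<Omega> :: "'a::euclidean_space set" and u v :: "'a \<Rightarrow> real"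
  assumes "bounded \<Omega>" and lam: "real DIM('a) < lam"
    and \<rho>: "\<And>k. 0 < \<rho> k" "\<rho> \<longlonglongrightarrow> 0" and b: "b \<longlonglongrightarrow> 0"
    and K: "\<And>t. 0 < t \<Longrightarrow> 0 \<le> K t"
    and v: "\<And>k x y. x \<in> \<Omega> \<Longrightarrow> y \<in> \<Omega> \<Longrightarrow> dist x y < \<rho> k \<Longrightarrow> \<bar>v y - \<xi> k x\<bar> \<le> b k"
    and u: "\<And>t k x. 0 < t \<Longrightarrow> x \<in> \<Omega> \<Longrightarrow>
      {y \<in> \<Omega> \<inter> ball x (\<rho> k). t \<le> \<bar>u y - \<xi> k x\<bar>} \<in> lmeasurable \<and>
      measure lebesgue {y \<in> \<Omega> \<inter> ball x (\<rho> k). t \<le> \<bar>u y - \<xi> k x\<bar>} \<le> K t * \<rho> k powr lam"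
  shows "negligible {y \<in> \<Omega>. u y \<noteq> v y}"
proof -
  obtain R where "\<Omega> \<subseteq> cball 0 R" "0 \<le> R"
    using \<open>bounded \<Omega>\<close> by (force simp: bounded_pos)
  define c where "c = (2 * (R + 1)) ^ DIM('a)"
  have neg: "negligible {y \<in> \<Omega>. t \<le> \<bar>u y - v y\<bar>}" if t: "0 < t" for t
    unfolding negligible_outer_le
  proof (intro allI impI)
    fix e :: real assume e: "0 < e"
    \<comment> \<open>This sequence bounds the total measure of the exceptional sets: at most
      \<open>c / \<rho> k ^ DIM('a)\<close> balls, each contributing at most
      \<open>K (t / 2) * \<rho> k powr lam\<close>.\<close>
    have "(\<lambda>k. K (t / 2) * (c * \<rho> k powr (lam - DIM('a)))) \<longlonglongrightarrow> K (t / 2) * (c * 0)"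
      using tendsto_zero_powrI[OF \<rho>(2) tendsto_const, of "lam - DIM('a)"] \<rho>(1) lam
      by (intro tendsto_intros) (auto simp: less_imp_le)
    then have "\<forall>\<^sub>F k in sequentially. K (t / 2) * (c * \<rho> k powr (lam - DIM('a))) < e"
      using e by (intro order_tendstoD(2)) auto
    moreover have "\<forall>\<^sub>F k in sequentially. b k < t / 2" using b t by (intro order_tendstoD(2)) auto
    moreover have "\<forall>\<^sub>F k in sequentially. \<rho> k < 1" using \<rho>(2) by (intro order_tendstoD(2)) auto
    ultimately have "\<forall>\<^sub>F k in sequentially. K (t / 2) * (c * \<rho> k powr (lam - DIM('a))) < e \<and> b k < t / 2 \<and> \<rho> k < 1"
      by eventually_elim auto
    then obtain k where k: "K (t / 2) * (c * \<rho> k powr (lam - DIM('a))) < e" "b k < t / 2" "\<rho> k < 1"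
      by (auto simp: eventually_sequentially)
    obtain F where F: "F \<subseteq> \<Omega>" "finite F" "\<Omega> \<subseteq> (\<Union>x\<in>F. ball x (\<rho> k))" "real (card F) * \<rho> k ^ DIM('a) \<le> c"
      using finite_ball_covering[OF \<open>\<Omega> \<subseteq> cball 0 R\<close> \<open>0 \<le> R\<close> \<rho>(1)[of k]] k by (auto simp: c_def)
    define E where "E x = {y \<in> \<Omega> \<inter> ball x (\<rho> k). t / 2 \<le> \<bar>u y - \<xi> k x\<bar>}" for x
    have E: "E x \<in> lmeasurable" "measure lebesgue (E x) \<le> K (t / 2) * \<rho> k powr lam" if "x \<in> F" for x
      using u[of "t / 2" x k] t that F by (auto simp: E_def)
    show "\<exists>T. {y \<in> \<Omega>. t \<le> \<bar>u y - v y\<bar>} \<subseteq> T \<and> T \<in> lmeasurable \<and> measure lebesgue T \<le> e"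
    proof (intro exI conjI)
      \<comment> \<open>As \<open>b k < t / 2\<close>, a gap of \<open>t\<close> between
        \<open>u\<close> and \<open>v\<close> leaves a gap of at least \<open>t / 2\<close> between
        \<open>u\<close> and the constant of the covering ball.\<close>
      show "{y \<in> \<Omega>. t \<le> \<bar>u y - v y\<bar>} \<subseteq> (\<Union>x\<in>F. E x)"
      proof
        fix y assume y: "y \<in> {y \<in> \<Omega>. t \<le> \<bar>u y - v y\<bar>}"
        then obtain x where x: "x \<in> F" "y \<in> ball x (\<rho> k)" using F by auto
        then have "\<bar>v y - \<xi> k x\<bar> \<le> b k" using v[of x y k] F y by auto
      moreover have "t \<le> \<bar>u y - v y\<bar>" using y by simp
        ultimately have "t / 2 \<le> \<bar>u y - \<xi> k x\<bar>" using k(2) by linarith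
        then show "y \<in> (\<Union>x\<in>F. E x)" using x y by (auto simp: E_def intro!: bexI[of _ x])
      qed
      show "(\<Union>x\<in>F. E x) \<in> lmeasurable" using E F by (intro fmeasurable.finite_UN) auto
      have "measure lebesgue (\<Union>x\<in>F. E x) \<le> (\<Sum>x\<in>F. measure lebesgue (E x))"
        using E F by (intro measure_UNION_le) auto
      also have "\<dots> \<le> real (card F) * (K (t / 2) * \<rho> k powr lam)"
        using E by (intro sum_bounded_above) auto
      also have "\<dots> = K (t / 2) * (real (card F) * \<rho> k ^ DIM('a)) * \<rho> k powr (lam - DIM('a))"
        using \<rho>(1)[of k] by (simp add: powr_diff powr_realpow)
      also have "\<dots> \<le> K (t / 2) * c * \<rho> k powr (lam - DIM('a))"
        using K[of "t / 2"] t F(4) by (intro mult_right_mono mult_left_mono) auto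
      finally show "measure lebesgue (\<Union>x\<in>F. E x) \<le> e" using k by (simp add: mult.assoc)
    qed
  qed
  have "{y \<in> \<Omega>. u y \<noteq> v y} \<subseteq> (\<Union>n. {y \<in> \<Omega>. 1 / real (Suc n) \<le> \<bar>u y - v y\<bar>})"
  proof
    fix y assume y: "y \<in> {y \<in> \<Omega>. u y \<noteq> v y}"
    then obtain n where "inverse (real (Suc n)) < \<bar>u y - v y\<bar>" using reals_Archimedean[of "\<bar>u y - v y\<bar>"] by auto
    then show "y \<in> (\<Union>n. {y \<in> \<Omega>. 1 / real (Suc n) \<le> \<bar>u y - v y\<bar>})"
      using y by (auto simp: inverse_eq_divide intro!: exI[of _ n])
  qed
  then show ?thesis
    by (rule negligible_subset[rotated]) (intro negligible_Union_nat neg; simp)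
qed

subsection \<open>The Hoelder continuous representative\<close>

lemma chebyshev_young:
  fixes \<Omega> :: "(real ^ 'n) set"
  assumes st: "young_standing n \<delta> g0 G" and meas: "u \<in> borel_measurable (lebesgue_on \<Omega>)"
    and op: "open \<Omega>" and bdd: "bounded \<Omega>" and t: "0 < t"
    and int: "(\<integral>\<^sup>+x\<in>\<Omega> \<inter> ball x0 \<rho>. ennreal (G \<bar>u x - \<xi>\<bar>) \<partial>lebesgue) \<le> ennreal c" and c: "0 \<le> c"
  defines "E \<equiv> {y \<in> \<Omega> \<inter> ball x0 \<rho>. t \<le> \<bar>u y - \<xi>\<bar>}"
  shows "E \<in> lmeasurable" and "measure lebesgue E \<le> c / G t"
proof -
  have "{y \<in> space (lebesgue_on \<Omega>). t \<le> \<bar>u y - \<xi>\<bar>} \<in> sets (lebesgue_on \<Omega>)"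
    using meas by measurable
  then have "{y \<in> \<Omega>. t \<le> \<bar>u y - \<xi>\<bar>} \<in> sets lebesgue"
    using op by (auto simp: sets_restrict_space_iff)
  then have "{y \<in> \<Omega>. t \<le> \<bar>u y - \<xi>\<bar>} \<inter> ball x0 \<rho> \<in> sets lebesgue"
    by (intro sets.Int) auto
  also have "{y \<in> \<Omega>. t \<le> \<bar>u y - \<xi>\<bar>} \<inter> ball x0 \<rho> = E" by (auto simp: E_def)
  finally have Es: "E \<in> sets lebesgue" .
  moreover have "bounded E" using bdd by (rule bounded_subset) (auto simp: E_def)
  ultimately show El: "E \<in> lmeasurable" by (rule bounded_set_imp_lmeasurable[rotated])
  have Gt: "0 < G t" using young_positive[OF st t] .
  have "ennreal (G t) * emeasure lebesgue E = (\<integral>\<^sup>+x. ennreal (G t) * indicator E x \<partial>lebesgue)"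
    using Es by (simp add: nn_integral_cmult_indicator)
  also have "\<dots> \<le> (\<integral>\<^sup>+x\<in>\<Omega> \<inter> ball x0 \<rho>. ennreal (G \<bar>u x - \<xi>\<bar>) \<partial>lebesgue)"
  proof (rule nn_integral_mono)
    fix x
    show "ennreal (G t) * indicator E x \<le> ennreal (G \<bar>u x - \<xi>\<bar>) * indicator (\<Omega> \<inter> ball x0 \<rho>) x"
    proof (cases "x \<in> E")
      case True
      then have "t \<le> \<bar>u x - \<xi>\<bar>" by (simp add: E_def)
      then have "G t \<le> G \<bar>u x - \<xi>\<bar>" using young_strict_mono[OF st, of t "\<bar>u x - \<xi>\<bar>"] t
        by (cases "t = \<bar>u x - \<xi>\<bar>") auto
      then show ?thesis using True by (auto simp: E_def ennreal_leI)
    qed simp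
  qed
  also have "\<dots> \<le> ennreal c" by (rule int)
  finally have "ennreal (G t * measure lebesgue E) \<le> ennreal c"
    using El Gt by (simp add: emeasure_eq_measure2 ennreal_mult)
  then have "G t * measure lebesgue E \<le> c" using c by simp
  then show "measure lebesgue E \<le> c / G t" using Gt by (simp add: field_simps)
qed

text \<open>Strictness of the hypothesis passes to the infimum over \<xi>, so some constant stays
  below the bound even if the infimum is not attained.\<close>

lemma campanato_centre:
  fixes \<Omega> :: "(real ^ 'n) set"
  assumes "campanato_seminorm G lam \<Omega> u < ennreal c" and "x0 \<in> \<Omega>" "0 < \<rho>"
  shows "\<exists>\<xi>. (\<integral>\<^sup>+x\<in>\<Omega> \<inter> ball x0 \<rho>. ennreal (G \<bar>u x - \<xi>\<bar>) \<partial>lebesgue) \<le> ennreal (\<rho> powr lam * c)"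
proof -
  let ?I = "\<lambda>\<xi>. \<integral>\<^sup>+x\<in>\<Omega> \<inter> ball x0 \<rho>. ennreal (G \<bar>u x - \<xi>\<bar>) \<partial>lebesgue"
  have "ennreal (\<rho> powr (- lam)) * (INF \<xi>. ?I \<xi>) \<le> campanato_seminorm G lam \<Omega> u"
    unfolding campanato_seminorm_def using assms by (intro SUP_upper2[of x0] SUP_upper2[of \<rho>]) auto
  also note assms(1)
  finally have "ennreal (\<rho> powr lam) * (ennreal (\<rho> powr (- lam)) * (INF \<xi>. ?I \<xi>)) < ennreal (\<rho> powr lam) * ennreal c"
    using assms by (intro ennreal_mult_strict_left_mono) auto
  moreover have "ennreal (\<rho> powr lam) * ennreal (\<rho> powr (- lam)) = 1"
    using assms by (simp flip: ennreal_mult powr_add)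
  ultimately have "(INF \<xi>. ?I \<xi>) < ennreal (\<rho> powr lam * c)"
    by (simp add: ennreal_mult' flip: mult.assoc)
  then show ?thesis by (auto simp: INF_less_iff intro: less_imp_le)
qed

text \<open>With \<open>\<theta> = (\<rho> / D) powr \<gamma>\<close> the argument of
  \<open>G\<close> is \<open>\<theta> * (M * D powr \<gamma>) * T\<close>. Power scaling removes
  \<theta> at the cost of \<open>(\<rho> / D) powr (lam - d)\<close>, which the choice of \<gamma>
  matches to the desired \<open>\<rho> powr d\<close>; convex scaling removes
  \<open>M * D powr \<gamma>\<close> and makes the ratio small for large \<open>M\<close>.\<close>

lemma young_ratio:
  assumes st: "young_standing n \<delta> g0 G" and \<gamma>: "\<gamma> * (g0 + 1) = lam - d" and \<rho>: "0 < \<rho>" "\<rho> \<le> D"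
    and M: "1 \<le> M * D powr \<gamma>" and T: "0 < T" and \<gamma>0: "0 \<le> \<gamma>"
  shows "\<rho> powr lam * G T / G (M * \<rho> powr \<gamma> * T) \<le> \<rho> powr d * (D powr (lam - d) / (M * D powr \<gamma>))"
proof -
  define \<theta> where "\<theta> = (\<rho> / D) powr \<gamma>"
  have \<theta>: "0 < \<theta>" "\<theta> \<le> 1" using \<rho> \<gamma>0 powr_mono2[of \<gamma> "\<rho> / D" 1] by (auto simp: \<theta>_def)
  have "M * \<rho> powr \<gamma> * T = \<theta> * (M * D powr \<gamma> * T)"
    using \<rho> by (simp add: \<theta>_def powr_divide)
  moreover have "\<theta> powr (g0 + 1) * G (M * D powr \<gamma> * T) \<le> G (\<theta> * (M * D powr \<gamma> * T))"
    using \<theta> M T by (intro young_powr_scaling[OF st]) auto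
  moreover have "M * D powr \<gamma> * G T \<le> G (M * D powr \<gamma> * T)"
    using M T by (intro young_convex_scaling[OF st]) auto
  ultimately have le: "\<theta> powr (g0 + 1) * (M * D powr \<gamma> * G T) \<le> G (M * \<rho> powr \<gamma> * T)"
    using \<theta> by (smt (verit) mult_left_mono powr_ge_zero)
  have \<theta>p: "\<theta> powr (g0 + 1) = \<rho> powr (lam - d) / D powr (lam - d)"
    using \<rho> by (simp add: \<theta>_def powr_powr \<gamma> powr_divide)
  have GT: "0 < G T" using young_positive[OF st T] .
  have M0: "0 < M" using M by (smt (verit) mult_nonpos_nonneg powr_ge_zero)
  have pos: "0 < \<theta> powr (g0 + 1) * (M * D powr \<gamma> * G T)"
    using \<theta> M0 GT \<rho> by (intro mult_pos_pos) auto
  have "\<rho> powr lam * G T / G (M * \<rho> powr \<gamma> * T) \<le> \<rho> powr lam * G T / (\<theta> powr (g0 + 1) * (M * D powr \<gamma> * G T))"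
    using le pos GT by (intro divide_left_mono mult_pos_pos[OF order_less_le_trans[OF pos le] pos]) auto
  also have "\<dots> = \<rho> powr d * (D powr (lam - d) / (M * D powr \<gamma>))"
    using GT \<rho> M0 unfolding \<theta>p by (simp add: powr_diff field_simps)
  finally show ?thesis .
qed

text \<open>The conditions on \<open>M\<close> make each exceptional set at most a quarter of the
  volume of a ball of radius \<open>s * \<rho> / 2\<close>. This makes the chosen constants
  comparable across neighbouring balls, and their dyadic limits form \<open>v\<close>.\<close>

lemma campanato_hoelder_representative:
  fixes \<Omega> :: "(real ^ 'n) set" and u :: "real ^ 'n \<Rightarrow> real"
  assumes st: "young_standing CARD('n) \<delta> g0 G" and bdd: "bounded \<Omega>" and op: "open \<Omega>"
    and lam: "real CARD('n) < lam" and \<gamma>: "\<gamma> * (g0 + 1) = lam - CARD('n)" "0 < \<gamma>"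
    and D: "0 < D" "\<And>x y. x \<in> \<Omega> \<Longrightarrow> y \<in> \<Omega> \<Longrightarrow> dist x y \<le> D / 2"
    and s: "0 < s" "\<And>x \<rho>. x \<in> \<Omega> \<Longrightarrow> 0 < \<rho> \<Longrightarrow> \<rho> \<le> D \<Longrightarrow> \<exists>z. ball z (s * \<rho>) \<subseteq> \<Omega> \<inter> ball x \<rho>"
    and M: "1 \<le> M * D powr \<gamma>"
      "D powr (lam - CARD('n)) / (M * D powr \<gamma>) \<le> unit_ball_vol CARD('n) * (s / 2) ^ CARD('n) / 4"
    and meas: "u \<in> borel_measurable (lebesgue_on \<Omega>)"
    and T: "0 < T" "campanato_seminorm G lam \<Omega> u < ennreal (G T)"
    and q: "q = 2 powr (- \<gamma>)"
  shows "\<exists>v. negligible {x \<in> \<Omega>. u x \<noteq> v x} \<and> (\<forall>x\<in>\<Omega>. \<forall>y\<in>\<Omega>.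
    \<bar>v x - v y\<bar> \<le> (2 / (1 - q) + 1) * (2 * M * D powr \<gamma> * T) * (4 / D) powr \<gamma> * dist x y powr \<gamma>)"
proof -
  have M0: "0 < M" using M(1) by (smt (verit) mult_nonpos_nonneg powr_ge_zero)
  have q01: "0 < q" "q < 1" using \<gamma> powr_less_cancel_iff[of 2 "- \<gamma>" 0] by (auto simp: q)
  let ?V = "unit_ball_vol CARD('n)"
  have V: "0 < ?V" by simp
  define \<rho> where "\<rho> k = D / 2 ^ k" for k :: nat
  have \<rho>: "0 < \<rho> k" "\<rho> k \<le> D" "\<rho> (Suc k) = \<rho> k / 2" for k using D by (auto simp: \<rho>_def field_simps)
  have \<rho>q: "\<rho> k powr \<gamma> = D powr \<gamma> * q ^ k" for k
  proof -
    have "\<rho> k = D * (2 powr (- real k))" by (simp add: \<rho>_def powr_minus powr_realpow divide_inverse)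
    also have "\<dots> powr \<gamma> = D powr \<gamma> * (2 powr (- \<gamma>)) powr real k"
      using D by (simp add: powr_mult powr_powr mult.commute)
    finally show ?thesis by (simp add: q powr_realpow)
  qed
  define \<xi> where "\<xi> k x = (SOME \<xi>. (\<integral>\<^sup>+y\<in>\<Omega> \<inter> ball x (\<rho> k). ennreal (G \<bar>u y - \<xi>\<bar>) \<partial>lebesgue)
    \<le> ennreal (\<rho> k powr lam * G T))" for k x
  have \<xi>: "(\<integral>\<^sup>+y\<in>\<Omega> \<inter> ball x (\<rho> k). ennreal (G \<bar>u y - \<xi> k x\<bar>) \<partial>lebesgue) \<le> ennreal (\<rho> k powr lam * G T)"
    if "x \<in> \<Omega>" for x k
    unfolding \<xi>_def by (rule someI_ex[OF campanato_centre[OF T(2) that \<rho>(1)]])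
  have GT: "0 < G T" using young_positive[OF st T(1)] .
  define E where "E k x t = {y \<in> \<Omega> \<inter> ball x (\<rho> k). t \<le> \<bar>u y - \<xi> k x\<bar>}" for k x t
  have E: "E k x t \<in> lmeasurable" "measure lebesgue (E k x t) \<le> \<rho> k powr lam * G T / G t"
    if "x \<in> \<Omega>" "0 < t" for k x t
    unfolding E_def using chebyshev_young[OF st meas op bdd that(2) \<xi>[OF that(1)]] GT by auto
  \<comment> \<open>The tolerance at level \<open>k\<close> scales like
    \<open>\<rho> k powr \<gamma>\<close>, so by \<open>\<rho>q\<close> it decays geometrically with
    ratio \<open>q\<close>.\<close>
  define w where "w k = M * \<rho> k powr \<gamma> * T" for k
  have w: "0 < w k" for k using M0 T \<rho>(1)[of k] by (simp add: w_def)
  have bad: "measure lebesgue (E k x (w k)) \<le> ?V * (s / 2) ^ CARD('n) / 4 * \<rho> k ^ CARD('n)" if "x \<in> \<Omega>" for x k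
  proof -
    have "measure lebesgue (E k x (w k)) \<le> \<rho> k powr lam * G T / G (w k)" by (rule E[OF that w])
    also have "\<dots> \<le> \<rho> k powr CARD('n) * (D powr (lam - CARD('n)) / (M * D powr \<gamma>))"
      unfolding w_def using \<rho> M T \<gamma> by (intro young_ratio[OF st]) auto
    also have "\<dots> \<le> \<rho> k powr CARD('n) * (?V * (s / 2) ^ CARD('n) / 4)"
      using M(2) by (intro mult_left_mono) auto
    finally show ?thesis using \<rho>(1)[of k] by (simp add: powr_realpow mult.commute)
  qed
  \<comment> \<open>The exceptional sets are too small to fill the ball contained in the smaller neighbourhood, so
    some point is good for both centres.\<close>
  have step: "\<bar>\<xi> k x - \<xi> (Suc k) y\<bar> \<le> (2 * M * D powr \<gamma> * T) * q ^ k"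
    if x: "x \<in> \<Omega>" and y: "y \<in> \<Omega>" and d: "dist x y \<le> D / 2 ^ Suc k" for k x y
  proof -
    obtain z where z: "ball z (s * \<rho> (Suc k)) \<subseteq> \<Omega> \<inter> ball y (\<rho> (Suc k))" using s(2)[OF y \<rho>(1,2)] by blast
    have sub: "ball y (\<rho> (Suc k)) \<subseteq> ball x (\<rho> k)"
    proof
      fix p assume "p \<in> ball y (\<rho> (Suc k))"
      then show "p \<in> ball x (\<rho> k)" using d \<rho>(3)[of k] dist_triangle[of x p y] by (simp add: \<rho>_def)
    qed
    \<comment> \<open>The volume of the inner ball at level \<open>Suc k\<close>, since
      \<open>s * \<rho> (Suc k) = (s / 2) * \<rho> k\<close>. Each exceptional set has measure at
      most \<open>?m / 4\<close>, so their union fills at most half of that ball.\<close>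
    let ?m = "?V * (s / 2) ^ CARD('n) * \<rho> k ^ CARD('n)"
    have "0 < ?m" using V s(1) \<rho>(1)[of k] by (intro mult_pos_pos) auto
    have "measure lebesgue (ball z (s * \<rho> (Suc k))) = ?V * (s * \<rho> (Suc k)) ^ CARD('n)"
      using s(1) \<rho>(1)[of "Suc k"] by (simp add: content_ball)
    also have "\<dots> = ?m" by (simp add: \<rho>(3) power_mult_distrib power_divide)
    finally have b: "measure lebesgue (ball z (s * \<rho> (Suc k))) = ?m" .
    have "\<rho> (Suc k) ^ CARD('n) \<le> \<rho> k ^ CARD('n)"
      using \<rho>(1)[of k] unfolding \<rho>(3) by (intro power_mono) auto
    then have "?V * (s / 2) ^ CARD('n) / 4 * \<rho> (Suc k) ^ CARD('n) \<le> ?V * (s / 2) ^ CARD('n) / 4 * \<rho> k ^ CARD('n)"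
      using V s(1) by (intro mult_left_mono) auto
    moreover have "measure lebesgue (E k x (w k) \<union> E (Suc k) y (w (Suc k)))
        \<le> measure lebesgue (E k x (w k)) + measure lebesgue (E (Suc k) y (w (Suc k)))"
      by (intro measure_Un_le fmeasurableD E x y w)
    ultimately have "measure lebesgue (E k x (w k) \<union> E (Suc k) y (w (Suc k))) \<le> ?m / 2"
      using bad[OF x, of k] bad[OF y, of "Suc k"] unfolding times_divide_eq_left by linarith
    then have "\<not> ball z (s * \<rho> (Suc k)) \<subseteq> E k x (w k) \<union> E (Suc k) y (w (Suc k))"
      using b \<open>0 < ?m\<close> measure_mono_fmeasurable[of "ball z (s * \<rho> (Suc k))" "E k x (w k) \<union> E (Suc k) y (w (Suc k))" lebesgue]
        E(1)[OF x w] E(1)[OF y w]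
      by (auto simp: fmeasurable.Un)
    then obtain p where p: "p \<in> ball z (s * \<rho> (Suc k))" "p \<notin> E k x (w k)" "p \<notin> E (Suc k) y (w (Suc k))" by blast
    then have "p \<in> \<Omega>" "p \<in> ball x (\<rho> k)" "p \<in> ball y (\<rho> (Suc k))" using z sub by blast+
    then have "\<bar>u p - \<xi> k x\<bar> < w k" "\<bar>u p - \<xi> (Suc k) y\<bar> < w (Suc k)"
      using p(2,3) by (auto simp: E_def not_le)
    moreover have "w (Suc k) \<le> w k"
      unfolding w_def \<rho>(3) using \<rho>(1)[of k] M0 T \<gamma> by (intro mult_right_mono mult_left_mono powr_mono2) auto
    ultimately have "\<bar>\<xi> k x - \<xi> (Suc k) y\<bar> \<le> 2 * w k" by linarith
    then show ?thesis by (simp add: w_def \<rho>q mult_ac)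
  qed
  define N where "N = 2 * M * D powr \<gamma> * T"
  define v where "v x = lim (\<lambda>k. \<xi> k x)" for x
  have limits: "\<bar>v x - \<xi> k x\<bar> \<le> N / (1 - q) * q ^ k"
      "\<bar>v x - v y\<bar> \<le> (2 / (1 - q) + 1) * N * (4 / D) powr \<gamma> * dist x y powr \<gamma>"
    if xy: "x \<in> \<Omega>" "y \<in> \<Omega>" for x y k
    unfolding v_def N_def
    by (rule dyadic_hoelder_limit[where S = \<Omega> and \<xi> = \<xi>, OF \<gamma>(2) D(1) q D(2) step xy]; assumption)+
  \<comment> \<open>Radii are shifted by one against the constants: \<open>\<xi> k x\<close> is used
    on the ball of radius \<open>\<rho> (Suc k)\<close>, where \<open>step\<close> compares it with
    \<open>\<xi> (Suc k) y\<close>. The shift costs the factor \<open>2 powr lam\<close>, as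
    \<open>\<rho> k = 2 * \<rho> (Suc k)\<close>.\<close>
  have "negligible {y \<in> \<Omega>. u y \<noteq> v y}"
  proof (rule negligible_ne_of_local_approximation[OF bdd])
    show "real DIM(real ^ 'n) < lam" using lam by simp
    show "0 < \<rho> (Suc k)" for k by (rule \<rho>)
    show "(\<lambda>k. \<rho> (Suc k)) \<longlonglongrightarrow> 0"
    proof -
      have "(\<lambda>k. D * (1 / 2) ^ Suc k) \<longlonglongrightarrow> D * 0"
        by (intro tendsto_intros LIMSEQ_Suc) simp
      then show ?thesis by (simp add: \<rho>_def power_divide)
    qed
    show "(\<lambda>k. N * q ^ k + N / (1 - q) * q ^ Suc k) \<longlonglongrightarrow> 0"
    proof -
      have "(\<lambda>k. N * q ^ k + N / (1 - q) * q ^ Suc k) \<longlonglongrightarrow> N * 0 + N / (1 - q) * 0"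
        using q01 by (intro tendsto_intros LIMSEQ_Suc LIMSEQ_power_zero) auto
      then show ?thesis by simp
    qed
    show "0 \<le> 2 powr lam * G T / G t" if "0 < t" for t
      using GT young_positive[OF st that] by simp
    show "\<bar>v y - \<xi> k x\<bar> \<le> N * q ^ k + N / (1 - q) * q ^ Suc k"
      if "x \<in> \<Omega>" "y \<in> \<Omega>" "dist x y < \<rho> (Suc k)" for k x y
      using limits(1)[OF that(2) that(2), of "Suc k"] step[OF that(1,2), of k] that(3)
      by (simp add: \<rho>_def N_def del: power_Suc)
    fix t k x assume t: "0 < (t::real)" and x: "x \<in> \<Omega>"
    let ?S = "{y \<in> \<Omega> \<inter> ball x (\<rho> (Suc k)). t \<le> \<bar>u y - \<xi> k x\<bar>}"
    have int: "(\<integral>\<^sup>+y\<in>\<Omega> \<inter> ball x (\<rho> (Suc k)). ennreal (G \<bar>u y - \<xi> k x\<bar>) \<partial>lebesgue) \<le> ennreal (\<rho> k powr lam * G T)"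
    proof (rule order_trans[OF nn_integral_mono \<xi>[OF x, of k]])
      fix y
      show "ennreal (G \<bar>u y - \<xi> k x\<bar>) * indicator (\<Omega> \<inter> ball x (\<rho> (Suc k))) y
        \<le> ennreal (G \<bar>u y - \<xi> k x\<bar>) * indicator (\<Omega> \<inter> ball x (\<rho> k)) y"
        using \<rho>(3)[of k] \<rho>(1)[of k] by (intro mult_left_mono) (auto simp: indicator_def)
    qed
    have "\<rho> k powr lam = 2 powr lam * \<rho> (Suc k) powr lam"
      using \<rho>(1)[of k] by (simp add: \<rho>(3) powr_divide)
    then show "?S \<in> lmeasurable \<and> measure lebesgue ?S \<le> 2 powr lam * G T / G t * \<rho> (Suc k) powr lam"
      using chebyshev_young[OF st meas op bdd t int] GT by (simp add: mult_ac)
  qed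
  then show ?thesis using limits(2) unfolding N_def by blast
qed

section \<open>Continuity and uniqueness of the representative, and the final bound\<close>

lemma hoelder_bound_imp_continuous_on:
  fixes v :: "'a::metric_space \<Rightarrow> real"
  assumes "0 < \<gamma>" and v: "\<And>x y. x \<in> S \<Longrightarrow> y \<in> S \<Longrightarrow> \<bar>v x - v y\<bar> \<le> A * dist x y powr \<gamma>"
  shows "continuous_on S v"
  unfolding continuous_on_def
proof
  fix x assume x: "x \<in> S"
  have "((\<lambda>y. A * dist y x powr \<gamma>) \<longlongrightarrow> A * 0) (at x within S)"
    using \<open>0 < \<gamma>\<close> by (intro tendsto_mult tendsto_const tendsto_zero_powrI[of _ _ _ \<gamma>])
      (auto simp: tendsto_dist_iff[symmetric])
  then have "((\<lambda>y. A * dist y x powr \<gamma>) \<longlongrightarrow> 0) (at x within S)" by simp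
  then have "((\<lambda>y. v y - v x) \<longlongrightarrow> 0) (at x within S)"
    by (rule Lim_null_comparison[rotated]) (use v x in \<open>auto simp: eventually_at_filter\<close>)
  then show "(v \<longlongrightarrow> v x) (at x within S)" by (simp add: LIM_zero_iff)
qed

text \<open>The set where the functions differ is open, and a nonempty open set is not
  negligible.\<close>

lemma continuous_on_open_eq_of_negligible:
  fixes v w :: "'a::euclidean_space \<Rightarrow> real"
  assumes "open S" "continuous_on S v" "continuous_on S w" "negligible {x \<in> S. v x \<noteq> w x}" "x \<in> S"
  shows "v x = w x"
proof -
  have "open (S \<inter> (\<lambda>x. v x - w x) -` (- {0}))"
    using assms by (intro continuous_open_preimage continuous_intros) auto
  also have "S \<inter> (\<lambda>x. v x - w x) -` (- {0}) = {x \<in> S. v x \<noteq> w x}" by auto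
  finally have "{x \<in> S. v x \<noteq> w x} = {}" using open_not_negligible assms(4) by blast
  then show ?thesis using assms(5) by auto
qed

theorem theorem4p3:
  fixes \<Omega> :: "(real ^ 'n) set" and lam g0 :: real
  assumes "bounded \<Omega>" and "lipschitz_domain \<Omega>" and "lam > real CARD('n)"
  shows "\<exists>C>0. \<forall>\<delta> G. young_standing CARD('n) \<delta> g0 G \<longrightarrow>
           (\<forall>u C0. u \<in> borel_measurable (lebesgue_on \<Omega>) \<longrightarrow> C0 > 0 \<longrightarrow>
              (\<integral>\<^sup>+x\<in>\<Omega>. ennreal (G \<bar>u x\<bar>) \<partial>lebesgue) + campanato_seminorm G lam \<Omega> u \<le> ennreal C0 \<longrightarrow>
              (\<exists>v. (AE x in lebesgue_on \<Omega>. v x = u x) \<and>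
                   v \<in> hoelder_space ((lam - real CARD('n)) / (g0 + 1)) \<Omega> \<and>
                   hoelder_seminorm ((lam - real CARD('n)) / (g0 + 1)) \<Omega> v
                     \<le> ennreal (C * young_inverse G (enn2real (campanato_seminorm G lam \<Omega> u)))))"
proof (cases "1 < g0")
  \<comment> \<open>The standing assumptions contain \<open>1 < \<delta>\<close> and
    \<open>\<delta> \<le> g0\<close>, so here no \<open>G\<close> is admissible and any positive
    constant serves.\<close>
  case False
  then have "\<not> young_standing CARD('n) \<delta> g0 G" for \<delta> G by (auto simp: young_standing_def)
  then show ?thesis by (intro exI[of _ 1]) auto
next
  case True
  define \<gamma> where "\<gamma> = (lam - real CARD('n)) / (g0 + 1)"
  have \<gamma>: "\<gamma> * (g0 + 1) = lam - CARD('n)" "0 < \<gamma>" using True assms(3) by (auto simp: \<gamma>_def)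
  have op: "open \<Omega>" and ne: "\<Omega> \<noteq> {}" using assms(2) by (auto simp: lipschitz_domain_def)
  obtain R where R: "0 < R" "\<And>x. x \<in> \<Omega> \<Longrightarrow> norm x \<le> R" using assms(1) by (auto simp: bounded_pos)
  \<comment> \<open>Chosen so that \<open>D / 2 = 2 * R\<close> bounds the diameter of
    \<Omega>.\<close>
  define D where "D = 4 * R"
  have D: "0 < D" using R by (simp add: D_def)
  have diam: "dist x y \<le> D / 2" if "x \<in> \<Omega>" "y \<in> \<Omega>" for x y
    using norm_triangle_ineq4[of x y] R(2)[OF that(1)] R(2)[OF that(2)] by (simp add: D_def dist_norm)
  obtain s where s: "0 < s" "\<And>x \<rho>. x \<in> \<Omega> \<Longrightarrow> 0 < \<rho> \<Longrightarrow> \<rho> \<le> D \<Longrightarrow> \<exists>z. ball z (s * \<rho>) \<subseteq> \<Omega> \<inter> ball x \<rho>"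
    using lipschitz_domain_contains_ball[OF assms(2,1) D] by blast
  define \<kappa> where "\<kappa> = unit_ball_vol CARD('n) * (s / 2) ^ CARD('n) / 4"
  have \<kappa>: "0 < \<kappa>" using s(1) by (simp add: \<kappa>_def)
  \<comment> \<open>\<open>P\<close> is the value of \<open>M * D powr \<gamma>\<close>, large
    enough for both conditions on \<open>M\<close>. It is fixed before \<delta>, \<open>G\<close>
    and \<open>u\<close>, so \<open>C\<close> depends only on the dimension, \<open>g0\<close>,
    \<open>lam\<close> and \<Omega>.\<close>
  define P where "P = max 1 (D powr (lam - CARD('n)) / \<kappa>)"
  define M where "M = P / D powr \<gamma>"
  have MD: "M * D powr \<gamma> = P" using D by (simp add: M_def)
  have P: "1 \<le> P" "D powr (lam - CARD('n)) / P \<le> \<kappa>"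
  proof -
    show "1 \<le> P" by (simp add: P_def)
    have "D powr (lam - CARD('n)) / \<kappa> \<le> P" by (simp add: P_def)
    then show "D powr (lam - CARD('n)) / P \<le> \<kappa>" using \<kappa> \<open>1 \<le> P\<close> by (simp add: field_simps)
  qed
  define q where "q = 2 powr (- \<gamma>)"
  have q: "q < 1" using \<gamma> powr_less_cancel_iff[of 2 "- \<gamma>" 0] by (simp add: q_def)
  define C where "C = (2 / (1 - q) + 1) * (2 * P) * (4 / D) powr \<gamma>"
  have C: "0 < C" unfolding C_def using q P D by (intro mult_pos_pos add_pos_pos) auto
  have "\<exists>v. (AE x in lebesgue_on \<Omega>. v x = u x) \<and> v \<in> hoelder_space \<gamma> \<Omega> \<and>
      hoelder_seminorm \<gamma> \<Omega> v \<le> ennreal (C * young_inverse G (enn2real (campanato_seminorm G lam \<Omega> u)))"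
    if st: "young_standing CARD('n) \<delta> g0 G" and meas: "u \<in> borel_measurable (lebesgue_on \<Omega>)"
      and le: "(\<integral>\<^sup>+x\<in>\<Omega>. ennreal (G \<bar>u x\<bar>) \<partial>lebesgue) + campanato_seminorm G lam \<Omega> u \<le> ennreal C0"
    for \<delta> G u C0
  proof -
    let ?K = "campanato_seminorm G lam \<Omega> u"
    define T0 where "T0 = young_inverse G (enn2real ?K)"
    have T0: "0 \<le> T0" "G T0 = enn2real ?K"
      using young_inverse_works[OF st, of "enn2real ?K"] by (auto simp: T0_def)
    \<comment> \<open>The seminorm is finite, so \<open>enn2real\<close> loses nothing.\<close>
    have "?K \<le> ennreal C0" using le by (meson le_add_same_cancel2 order_trans zero_le add_increasing order_refl)
    then have K: "ennreal (enn2real ?K) = ?K"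
      by (intro ennreal_enn2real) (metis ennreal_less_top order_le_less_trans)
    have rep: "\<exists>v. negligible {x \<in> \<Omega>. u x \<noteq> v x} \<and>
        (\<forall>x\<in>\<Omega>. \<forall>y\<in>\<Omega>. \<bar>v x - v y\<bar> \<le> C * T * dist x y powr \<gamma>)" if T: "T0 < T" for T
    proof -
      have "G T0 < G T" by (rule young_strict_mono[OF st T0(1) T])
      then have "ennreal (G T0) < ennreal (G T)" using T0 by (subst ennreal_less_iff) auto
      then have "?K < ennreal (G T)" using K T0 by simp
      then have "\<exists>v. negligible {x \<in> \<Omega>. u x \<noteq> v x} \<and> (\<forall>x\<in>\<Omega>. \<forall>y\<in>\<Omega>.
          \<bar>v x - v y\<bar> \<le> (2 / (1 - q) + 1) * (2 * M * D powr \<gamma> * T) * (4 / D) powr \<gamma> * dist x y powr \<gamma>)"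
        using T0 T P MD
        by (intro campanato_hoelder_representative[OF st assms(1) op assms(3) \<gamma> D diam s _ _ meas _ _ q_def])
          (auto simp: \<kappa>_def)
      moreover have "(2 / (1 - q) + 1) * (2 * M * D powr \<gamma> * T) * (4 / D) powr \<gamma> = C * T"
        by (simp add: C_def MD[symmetric] mult_ac)
      ultimately show ?thesis by simp
    qed
    obtain v where v: "negligible {x \<in> \<Omega>. u x \<noteq> v x}"
      and v1: "\<And>x y. x \<in> \<Omega> \<Longrightarrow> y \<in> \<Omega> \<Longrightarrow> \<bar>v x - v y\<bar> \<le> C * (T0 + 1) * dist x y powr \<gamma>"
      using rep[of "T0 + 1"] by auto
    have cont: "continuous_on \<Omega> v" by (rule hoelder_bound_imp_continuous_on[OF \<gamma>(2) v1])
    \<comment> \<open>The representative supplied by \<open>rep\<close> may depend on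
      \<open>T\<close>, but all of them are continuous and agree with \<open>u\<close> almost
      everywhere. They coincide on \<Omega>, so the single \<open>v\<close> inherits the bound for
      every \<open>T > T0\<close>.\<close>
    have vT: "\<bar>v x - v y\<bar> \<le> C * T * dist x y powr \<gamma>" if T: "T0 < T" and xy: "x \<in> \<Omega>" "y \<in> \<Omega>" for T x y
    proof -
      obtain w where w: "negligible {x \<in> \<Omega>. u x \<noteq> w x}"
        and wT: "\<And>x y. x \<in> \<Omega> \<Longrightarrow> y \<in> \<Omega> \<Longrightarrow> \<bar>w x - w y\<bar> \<le> C * T * dist x y powr \<gamma>"
        using rep[OF T] by auto
      have "negligible {x \<in> \<Omega>. v x \<noteq> w x}"
        by (rule negligible_subset[OF negligible_Un[OF v w]]) auto
      then have "v z = w z" if "z \<in> \<Omega>" for z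
        using continuous_on_open_eq_of_negligible[OF op cont hoelder_bound_imp_continuous_on[OF \<gamma>(2) wT]] that
        by blast
      then show ?thesis using wT xy by simp
    qed
    \<comment> \<open>\<open>T0\<close> itself is not admissible: the infimum over \<open>\<xi>\<close> need not be attained, and \<open>T0\<close> may be \<open>0\<close>.\<close>
    have hoelder: "\<bar>v x - v y\<bar> \<le> C * T0 * dist x y powr \<gamma>" if xy: "x \<in> \<Omega>" "y \<in> \<Omega>" for x y
    proof (rule tendsto_lowerbound)
      show "((\<lambda>T. C * T * dist x y powr \<gamma>) \<longlongrightarrow> C * T0 * dist x y powr \<gamma>) (at_right T0)"
        by (intro tendsto_intros)
      show "\<forall>\<^sub>F T in at_right T0. \<bar>v x - v y\<bar> \<le> C * T * dist x y powr \<gamma>"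
        using eventually_at_right_less[of T0] by eventually_elim (rule vT[OF _ xy])
    qed simp
    have semi: "hoelder_seminorm \<gamma> \<Omega> v \<le> ennreal (C * T0)"
      unfolding hoelder_seminorm_def
    proof (intro SUP_least ennreal_leI)
      fix x y assume "x \<in> \<Omega>" "y \<in> \<Omega> - {x}"
      then show "\<bar>v x - v y\<bar> / norm (x - y) powr \<gamma> \<le> C * T0"
        using hoelder[of x y] by (auto simp: dist_norm divide_le_eq)
    qed
    obtain x0 where x0: "x0 \<in> \<Omega>" using ne by auto
    have "\<bar>v x\<bar> \<le> \<bar>v x0\<bar> + C * T0 * D powr \<gamma>" if x: "x \<in> \<Omega>" for x
    proof -
      have "dist x x0 powr \<gamma> \<le> D powr \<gamma>" using diam[OF x x0] D \<gamma> by (intro powr_mono2) auto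
      then have "C * T0 * dist x x0 powr \<gamma> \<le> C * T0 * D powr \<gamma>" using C T0 by (intro mult_left_mono) auto
      then show ?thesis using hoelder[OF x x0] by linarith
    qed
    then have "bounded (v ` \<Omega>)" by (auto simp: bounded_iff)
    moreover have "hoelder_seminorm \<gamma> \<Omega> v < \<infinity>" using semi by (rule order_le_less_trans) simp
    ultimately have "v \<in> hoelder_space \<gamma> \<Omega>" using cont by (simp add: hoelder_space_def)
    moreover have "AE x in lebesgue_on \<Omega>. v x = u x"
    proof -
      have "AE x in lebesgue. x \<notin> {x \<in> \<Omega>. u x \<noteq> v x}"
        using v by (intro AE_not_in) (simp add: negligible_iff_null_sets)
      then have "AE x in lebesgue. x \<in> \<Omega> \<longrightarrow> v x = u x" by eventually_elim auto
      then show ?thesis using op by (subst AE_restrict_space_iff) auto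
    qed
    ultimately show ?thesis using semi unfolding T0_def by blast
  qed
  then show ?thesis using C unfolding \<gamma>_def by blast
qed

end
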